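(* Let $m\ge 1$ and, for $i=1,\ldots,m$, let $\{X^{(i)}_j\}_{j\ge 0}$ be real random variables such that the families for different $i$ are independent of each other, and each family satisfies: $\{X^{(i)}_j\}_{j\ge0}$ are independent, $\mathrm{E}(X^{(i)}_j)=0$, $\mathrm{E}((X^{(i)}_j)^2)=1$ for all $j\ge0$, and $\sup_{j\ge0}\mathrm{E}(|X^{(i)}_j|^k)<\infty$ for every $k\ge3$. For each $n$ and $i$, let $SC^{(i)}_n$ be the $n\times n$ symmetric circulant matrix whose $(r,s)$-th entry is $X^{(i)}_{\frac n2-|\frac n2-|r-s||}/\sqrt n$. Let $\{b_i\}_{1\le i\le m}$ be independent standard Gaussian random variables. Then, as elements of the non-commutative probability space $(\mathcal M_n,\phi_n)$, $\{SC^{(i)}_n\}_{1\le i\le m}$ converges jointly to $\{b_i\}_{1\le i\le m}$; that is, for every complex polynomial $Q$ in $m$ non-commuting variables, $$\phi_n\big(Q(SC^{(1)}_n,\ldots,SC^{(m)}_n)\big)\to \mathrm{E}\big[Q(b_1,\ldots,b_m)\big]\quad\text{as } n\to\infty.$$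
   Context: $\mathcal M_n$ denotes the algebra of $n\times n$ random matrices whose entries have finite moments of all orders, and $\phi_n(A)=\frac1n\mathrm{E}[\mathrm{Tr}(A)]$; $(\mathcal M_n,\phi_n)$ is a non-commutative probability space (a unital complex algebra with a linear functional $\phi_n$ satisfying $\phi_n(I)=1$). The limit variables $b_i$ are viewed in the (commutative) probability space of random variables with all moments finite, with state given by expectation. *)

theory Defs
  imports "HOL-Probability.Probability"
begin

text \<open>Random n x n matrices are represented as functions
  \<open>'a \<Rightarrow> nat \<Rightarrow> nat \<Rightarrow> complex\<close> (sample point, row, column), with rows
  and columns indexed by \<open>{0..<n}\<close>.\<close>

type_synonym 'a rmat = "'a \<Rightarrow> nat \<Rightarrow> nat \<Rightarrow> complex"

definition rmat_mult :: "nat \<Rightarrow> 'a rmat \<Rightarrow> 'a rmat \<Rightarrow> 'a rmat" where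
  "rmat_mult n A B = (\<lambda>\<omega> r s. \<Sum>k<n. A \<omega> r k * B \<omega> k s)"

definition rmat_id :: "'a rmat" where
  "rmat_id = (\<lambda>\<omega> r s. if r = s then 1 else 0)"

definition rmat_word :: "nat \<Rightarrow> (nat \<Rightarrow> 'a rmat) \<Rightarrow> nat list \<Rightarrow> 'a rmat" where
  "rmat_word n A w = foldr (\<lambda>i B. rmat_mult n (A i) B) w rmat_id"

text \<open>A complex polynomial in m non-commuting variables: finitely supported
  coefficient function on words over the alphabet \<open>{1..m}\<close>.\<close>
definition nc_poly :: "nat \<Rightarrow> (nat list \<Rightarrow> complex) \<Rightarrow> bool" where
  "nc_poly m Q \<longleftrightarrow> finite {w. Q w \<noteq> 0} \<and> (\<forall>w. Q w \<noteq> 0 \<longrightarrow> set w \<subseteq> {1..m})"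

definition nc_eval_mat :: "nat \<Rightarrow> (nat list \<Rightarrow> complex) \<Rightarrow> (nat \<Rightarrow> 'a rmat) \<Rightarrow> 'a rmat" where
  "nc_eval_mat n Q A =
     (\<lambda>\<omega> r s. \<Sum>w\<in>{w. Q w \<noteq> 0}. Q w * rmat_word n A w \<omega> r s)"

definition nc_eval_rv :: "(nat list \<Rightarrow> complex) \<Rightarrow> (nat \<Rightarrow> 'b \<Rightarrow> real) \<Rightarrow> 'b \<Rightarrow> complex" where
  "nc_eval_rv Q b = (\<lambda>\<omega>. \<Sum>w\<in>{w. Q w \<noteq> 0}. Q w * (\<Prod>k<length w. complex_of_real (b (w ! k) \<omega>)))"

definition phi_n :: "'a measure \<Rightarrow> nat \<Rightarrow> 'a rmat \<Rightarrow> complex" where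
  "phi_n M n A = (1 / of_nat n) * (\<integral>\<omega>. (\<Sum>r<n. A \<omega> r r) \<partial>M)"

text \<open>Symmetric circulant matrix: entry (r,s) is
  \<open>X_{n/2 - |n/2 - |r-s||} / sqrt n\<close> (the index is always a natural number).\<close>
definition sc_index :: "nat \<Rightarrow> nat \<Rightarrow> nat \<Rightarrow> nat" where
  "sc_index n r s = nat \<lfloor>real n / 2 - \<bar>real n / 2 - \<bar>real r - real s\<bar>\<bar>\<rfloor>"

definition symcirc :: "nat \<Rightarrow> (nat \<Rightarrow> 'a \<Rightarrow> real) \<Rightarrow> 'a rmat" where
  "symcirc n X = (\<lambda>\<omega> r s. complex_of_real (X (sc_index n r s) \<omega> / sqrt (real n)))"

end

theory Submission
  imports Defs
begin

text \<open>
Symmetric circulant matrices of order \<open>n\<close> are simultaneously diagonalised by the discrete Fourier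
basis, so the trace of a word in them is \<open>\<Sum>k<n\<close> of the product of the \<open>k\<close>-th eigenvalues.
The \<open>k\<close>-th eigenvalue is a linear combination of the independent variables \<open>X j\<close>,
\<open>j \<le> n / 2\<close>, with coefficients \<open>O(1 / sqrt n)\<close>; its variance is \<open>1 + O(1 / n)\<close> unless
\<open>n\<close> divides \<open>2 * k\<close>, which happens for at most two \<open>k\<close>. Hence the moments of the \<open>k\<close>-th eigenvalue are
Gaussian up to \<open>O(1 / sqrt n)\<close>, uniformly in the remaining \<open>k\<close>, and independence of the families
turns the expected product of eigenvalues into a product of moments.
\<close>

subsection \<open>Fourier diagonalisation of symmetric circulant matrices\<close>

text \<open>The frequency \<open>k\<close> varies with \<open>n\<close> and all of them enter the
  average, so a central limit theorem for one eigenvalue at a time would not suffice, and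
  convergence in distribution alone would not give moments. Hence an explicit moment error whose
  constant depends only on the order and on the uniform moment bounds. Each trace term involves a
  single \<open>k\<close>, so the dependence between eigenvalues of the same matrix never has to be
  understood. At the exceptional frequencies the cosines are 1 or -1 throughout and the variance is
  close to 2; bounded moments are all that is needed there.\<close>

definition unity_root :: "nat \<Rightarrow> nat \<Rightarrow> complex" where
  "unity_root n a = cis (2 * pi * real a / real n)"

lemma unity_root_add: "unity_root n (a + b) = unity_root n a * unity_root n b"
  by (simp add: unity_root_def cis_mult ring_distribs add_divide_distrib)

lemma unity_root_power: "unity_root n a ^ t = unity_root n (a * t)"
  by (simp add: unity_root_def Complex.DeMoivre mult_ac)

lemma unity_root_eq_1_iff:
  assumes "n > 0"
  shows "unity_root n a = 1 \<longleftrightarrow> n dvd a"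
proof -
  have "unity_root n a = exp (2 * of_real pi * \<i> * of_nat a / of_nat n)"
    by (simp add: unity_root_def cis_conv_exp mult_ac)
  then show ?thesis
    using complex_root_unity_eq_1[of n a] assms by simp
qed

lemma unity_root_mod:
  assumes "n > 0"
  shows "unity_root n (k * (a mod n)) = unity_root n (k * a)"
proof -
  have "unity_root n (k * a) = unity_root n (k * (a mod n) + n * (k * (a div n)))"
    by (metis add.commute distrib_left mult.left_commute mult_div_mod_eq)
  also have "\<dots> = unity_root n (k * (a mod n))"
    using assms unity_root_eq_1_iff[of n "n * (k * (a div n))"] by (simp add: unity_root_add)
  finally show ?thesis by simp
qed

lemma unity_root_mult_cnj: "unity_root n a * cnj (unity_root n a) = 1"
  by (simp add: unity_root_def cis_cnj cis_mult)

lemma sum_unity_root_eq_0: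
  assumes "n > 0" "\<not> n dvd a"
  shows "(\<Sum>t<n. unity_root n (a * t)) = 0"
proof -
  have "(\<Sum>t<n. unity_root n (a * t)) = (\<Sum>t<n. unity_root n a ^ t)"
    by (simp add: unity_root_power)
  also have "\<dots> = (unity_root n a ^ n - 1) / (unity_root n a - 1)"
    using assms by (intro geometric_sum) (simp add: unity_root_eq_1_iff)
  also have "unity_root n a ^ n = 1"
    using assms by (simp add: unity_root_power unity_root_eq_1_iff)
  finally show ?thesis by simp
qed

lemma unity_root_orthogonality:
  assumes "r < n" "s < n"
  shows "(\<Sum>k<n. cnj (unity_root n (k * r)) * unity_root n (k * s)) = (if r = s then of_nat n else 0)"
proof (cases "r = s")
  case True
  then show ?thesis by (simp add: mult.commute[of "cnj _"] unity_root_mult_cnj)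
next
  case False
  \<comment> \<open>Exponents are natural numbers, so the conjugate is written with exponent
    \<open>n - r\<close>; \<open>r < n\<close> keeps this subtraction exact.\<close>
  have inv: "cnj (unity_root n (k * r)) = unity_root n (k * (n - r))" for k
  proof -
    have "unity_root n (k * r) * unity_root n (k * (n - r)) = unity_root n (k * n)"
      using assms by (simp add: unity_root_add[symmetric] ring_distribs[symmetric])
    also have "\<dots> = 1" using assms by (simp add: unity_root_eq_1_iff)
    finally have "cnj (unity_root n (k * r)) * (unity_root n (k * r) * unity_root n (k * (n - r)))
        = cnj (unity_root n (k * r))" by simp
    then show ?thesis
      using unity_root_mult_cnj[of n "k * r"]
      by (metis mult.assoc mult.commute mult_1)
  qed
  have nd: "\<not> n dvd (n - r) + s"
  proof
    assume "n dvd (n - r) + s"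
    moreover have "0 < (n - r) + s" "(n - r) + s < 2 * n" using assms by auto
    ultimately obtain q where q: "(n - r) + s = n * q" by blast
    with \<open>0 < _\<close> \<open>_ < 2 * n\<close> have "0 < q" "q < 2" by auto
    then have "q = 1" by simp
    with q have "r = s" using assms by simp
    with False show False by simp
  qed
  have "(\<Sum>k<n. cnj (unity_root n (k * r)) * unity_root n (k * s))
      = (\<Sum>k<n. unity_root n (((n - r) + s) * k))"
    by (simp add: inv unity_root_add[symmetric] ring_distribs mult.commute add.commute)
  also have "\<dots> = 0" using assms nd by (intro sum_unity_root_eq_0) auto
  finally show ?thesis using False by simp
qed

text \<open>The discrete Fourier transform of a row, reduced to its cosine part by reflection
  symmetry. The sum runs over all cyclic distances \<open>t\<close>, so most variables occur twice;
  it is regrouped by distinct variables once independence enters.\<close>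

definition circ_eig :: "nat \<Rightarrow> nat \<Rightarrow> (nat \<Rightarrow> real) \<Rightarrow> real" where
  "circ_eig n k x = (\<Sum>t<n. x (min t (n - t)) * cos (2 * pi * real k * real t / real n)) / sqrt (real n)"

lemma bij_betw_add_mod:
  fixes n r :: nat
  assumes "r < n"
  shows "bij_betw (\<lambda>t. (r + t) mod n) {..<n} {..<n}"
proof -
  have "inj_on (\<lambda>t. (r + t) mod n) {..<n}"
  proof (rule inj_onI)
    fix s t assume st: "s \<in> {..<n}" "t \<in> {..<n}" and "(r + s) mod n = (r + t) mod n"
    then show "s = t" using assms by (auto simp: mod_if split: if_splits)
  qed
  moreover have "(\<lambda>t. (r + t) mod n) ` {..<n} \<subseteq> {..<n}" using assms by auto
  ultimately show ?thesis
    by (simp add: bij_betw_def endo_inj_surj)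
qed

text \<open>The entry depends on the cyclic distance only: without wraparound the indices differ by
  \<open>t\<close>, with wraparound by \<open>n - t\<close>, and the index formula does not
  distinguish the two.\<close>

lemma sc_index_add_mod:
  assumes "r < n" "t < n"
  shows "sc_index n r ((r + t) mod n) = min t (n - t)"
proof -
  have *: "nat \<lfloor>real n / 2 - \<bar>real n / 2 - real d\<bar>\<rfloor> = min d (n - d)" if "d \<le> n" for d
  proof -
    have "real n / 2 - \<bar>real n / 2 - real d\<bar> = real (min d (n - d))"
      using that by (auto simp: min_def of_nat_diff abs_if field_simps)
    then show ?thesis by simp
  qed
  show ?thesis
  proof (cases "r + t < n")
    case True
    then have "\<bar>real r - real ((r + t) mod n)\<bar> = real t" by simp
    then show ?thesis using *[of t] assms by (simp add: sc_index_def)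
  next
    case False
    then have "(r + t) mod n = r + t - n" using assms by (simp add: mod_if)
    then have "\<bar>real r - real ((r + t) mod n)\<bar> = real (n - t)"
      using assms False by (simp add: of_nat_diff)
    then show ?thesis using *[of "n - t"] assms by (simp add: sc_index_def min.commute)
  qed
qed

text \<open>Sending \<open>t\<close> to \<open>n - t\<close> preserves the coefficients and reverses
  the sine, so the sum is its own negative. This makes the eigenvalues real.\<close>

lemma circulant_sine_sum_eq_0:
  fixes x :: "nat \<Rightarrow> real"
  shows "(\<Sum>t<n. x (min t (n - t)) * sin (2 * pi * real k * real t / real n)) = 0" (is "?S = 0")
proof (cases "n = 0")
  case False
  let ?f = "\<lambda>t. x (min t (n - t)) * sin (2 * pi * real k * real t / real n)"
  \<comment> \<open>The index 0, which the reflection would send outside the range, contributes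
    \<open>sin 0\<close>.\<close>
  have "?S = sum ?f {1..<n}"
    by (rule sum.mono_neutral_right) (auto simp: Suc_le_eq)
  moreover have "sum ?f {1..<n} = sum (\<lambda>t. - ?f t) {1..<n}"
  proof (rule sum.reindex_bij_witness[where i = "\<lambda>t. n - t" and j = "\<lambda>t. n - t"])
    fix t assume t: "t \<in> {1..<n}"
    have "2 * pi * real k * real (n - t) / real n = 2 * pi * real k - 2 * pi * real k * real t / real n"
      using t by (simp add: of_nat_diff field_simps)
    then have "sin (2 * pi * real k * real (n - t) / real n) = - sin (2 * pi * real k * real t / real n)"
      using sin_2npi[of k] cos_2npi[of k] by (simp add: sin_diff mult_ac)
    then show "- ?f (n - t) = ?f t" using t by (simp add: min.commute)
  qed auto
  ultimately show ?thesis by (simp add: sum_negf)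
qed simp

text \<open>Reading row \<open>r\<close> cyclically from its diagonal entry removes \<open>r\<close>
  from the matrix entries and pulls out \<open>unity_root n (k * r)\<close>. The eigenvector depends
  neither on \<open>X\<close> nor on \<open>\<omega>\<close>, which lets whole words be
  diagonalised.\<close>

lemma symcirc_eigenvector:
  assumes "r < n"
  shows "(\<Sum>s<n. symcirc n X \<omega> r s * unity_root n (k * s))
    = of_real (circ_eig n k (\<lambda>j. X j \<omega>)) * unity_root n (k * r)"
proof -
  let ?x = "\<lambda>j. X j \<omega>"
  have n: "n > 0" using assms by simp
  have "(\<Sum>s<n. symcirc n X \<omega> r s * unity_root n (k * s))
      = (\<Sum>t<n. symcirc n X \<omega> r ((r + t) mod n) * unity_root n (k * ((r + t) mod n)))"
    by (rule sum.reindex_bij_betw[OF bij_betw_add_mod[OF assms], symmetric])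
  also have "\<dots> = (\<Sum>t<n. of_real (?x (min t (n - t))) * unity_root n (k * t)) * unity_root n (k * r) / of_real (sqrt (real n))"
    unfolding sum_distrib_right sum_divide_distrib
    by (intro sum.cong refl)
       (simp add: unity_root_mod[OF n] symcirc_def sc_index_add_mod[OF assms] ring_distribs unity_root_add)
  also have "(\<Sum>t<n. of_real (?x (min t (n - t))) * unity_root n (k * t))
      = Complex (\<Sum>t<n. ?x (min t (n - t)) * cos (2 * pi * real k * real t / real n))
                (\<Sum>t<n. ?x (min t (n - t)) * sin (2 * pi * real k * real t / real n))"
    by (simp add: complex_eq_iff unity_root_def mult.assoc)
  finally show ?thesis
    unfolding circulant_sine_sum_eq_0[of ?x n k] complex_of_real_def[symmetric]
    by (simp only: circ_eig_def of_real_divide times_divide_eq_left times_divide_eq_right)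
qed

lemma rmat_word_eigenvector:
  assumes "r < n"
  shows "(\<Sum>s<n. rmat_word n (\<lambda>i. symcirc n (X i)) w \<omega> r s * unity_root n (k * s))
    = of_real (\<Prod>i\<leftarrow>w. circ_eig n k (\<lambda>j. X i j \<omega>)) * unity_root n (k * r)"
  using assms
proof (induction w arbitrary: r)
  case Nil
  have "(\<Sum>s<n. (if r = s then 1 else 0) * unity_root n (k * s)) = (\<Sum>s<n. if r = s then unity_root n (k * s) else 0)"
    by (intro sum.cong) auto
  then show ?case using Nil by (simp add: rmat_word_def rmat_id_def)
next
  case (Cons i w)
  let ?A = "symcirc n (X i)" and ?B = "rmat_word n (\<lambda>i. symcirc n (X i)) w"
  have "(\<Sum>s<n. rmat_word n (\<lambda>i. symcirc n (X i)) (i # w) \<omega> r s * unity_root n (k * s))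
      = (\<Sum>s<n. \<Sum>l<n. ?A \<omega> r l * (?B \<omega> l s * unity_root n (k * s)))"
    by (simp add: rmat_word_def rmat_mult_def sum_distrib_right mult.assoc)
  also have "\<dots> = (\<Sum>l<n. ?A \<omega> r l * (\<Sum>s<n. ?B \<omega> l s * unity_root n (k * s)))"
    by (subst sum.swap) (simp add: sum_distrib_left)
  also have "\<dots> = (\<Sum>l<n. ?A \<omega> r l * unity_root n (k * l)) * of_real (\<Prod>i\<leftarrow>w. circ_eig n k (\<lambda>j. X i j \<omega>))"
    by (simp add: Cons.IH sum_distrib_right mult.assoc) (simp only: mult.commute)
  finally show ?case
    by (simp only: symcirc_eigenvector[OF Cons.prems]) (simp add: mult_ac)
qed

text \<open>No inverse Fourier matrix is formed: orthogonality writes \<open>n\<close> times the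
  diagonal selector as a sum over frequencies, after which each inner sum is an eigenvector
  equation.\<close>

lemma trace_rmat_word:
  "(\<Sum>r<n. rmat_word n (\<lambda>i. symcirc n (X i)) w \<omega> r r)
    = of_real (\<Sum>k<n. \<Prod>i\<leftarrow>w. circ_eig n k (\<lambda>j. X i j \<omega>))"
proof (cases "n = 0")
  case False
  let ?B = "rmat_word n (\<lambda>i. symcirc n (X i)) w \<omega>"
  let ?e = "\<lambda>k r. unity_root n (k * r)"
  have "of_nat n * (\<Sum>r<n. ?B r r) = (\<Sum>r<n. \<Sum>s<n. ?B r s * (if r = s then of_nat n else 0))"
    by (simp add: sum_distrib_left mult.commute[of "of_nat n"] if_distrib[where f = "\<lambda>x. _ * x"] cong: if_cong)
  also have "\<dots> = (\<Sum>r<n. \<Sum>s<n. \<Sum>k<n. cnj (?e k r) * (?B r s * ?e k s))"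
    by (simp add: unity_root_orthogonality[symmetric] sum_distrib_left mult_ac)
  also have "\<dots> = (\<Sum>r<n. \<Sum>k<n. cnj (?e k r) * (\<Sum>s<n. ?B r s * ?e k s))"
    unfolding sum_distrib_left by (intro sum.cong refl sum.swap)
  also have "\<dots> = (\<Sum>r<n. \<Sum>k<n. of_real (\<Prod>i\<leftarrow>w. circ_eig n k (\<lambda>j. X i j \<omega>)))"
  proof (intro sum.cong refl)
    fix r k assume "r \<in> {..<n}"
    then show "cnj (?e k r) * (\<Sum>s<n. ?B r s * ?e k s) = of_real (\<Prod>i\<leftarrow>w. circ_eig n k (\<lambda>j. X i j \<omega>))"
      using unity_root_mult_cnj[of n "k * r"] by (simp add: rmat_word_eigenvector mult.left_commute[of "cnj _"] mult.commute[of "cnj _"])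
  qed
  finally show ?thesis using False by simp
qed simp

section \<open>The eigenvalues as linear forms in independent variables\<close>

definition fold_mult :: "nat \<Rightarrow> nat \<Rightarrow> real" where
  "fold_mult n j = (if j = 0 \<or> 2 * j = n then 1 else 2)"

text \<open>The fibre of \<open>min t (n - t)\<close> over \<open>j\<close> consists of
  \<open>j\<close> and \<open>n - j\<close>. It is a single point for \<open>j = 0\<close>, where
  \<open>n - j\<close> leaves the range, and for \<open>2 * j = n\<close>; \<open>fold_mult\<close>
  counts these points.\<close>

lemma sum_fold:
  fixes f :: "nat \<Rightarrow> real"
  assumes n: "n > 0"
  shows "(\<Sum>t<n. f (min t (n - t))) = (\<Sum>j\<le>n div 2. fold_mult n j * f j)"
proof -
  have "(\<Sum>t<n. f (min t (n - t))) = (\<Sum>j\<le>n div 2. of_nat (card {t \<in> {..<n}. min t (n - t) = j}) * f j)"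
    by (rule sum_fun_comp) auto
  also have "\<dots> = (\<Sum>j\<le>n div 2. fold_mult n j * f j)"
  proof (intro sum.cong refl)
    fix j assume "j \<in> {..n div 2}"
    then have "{t \<in> {..<n}. min t (n - t) = j} = (if j = 0 then {0} else {j, n - j})"
      using n by auto
    moreover have "n - j = j \<longleftrightarrow> 2 * j = n" using \<open>j \<in> _\<close> n by auto
    ultimately show "of_nat (card {t \<in> {..<n}. min t (n - t) = j}) * f j = fold_mult n j * f j"
      by (cases "j = 0"; cases "n - j = j") (simp_all add: fold_mult_def)
  qed
  finally show ?thesis .
qed

definition eig_coeff :: "nat \<Rightarrow> nat \<Rightarrow> nat \<Rightarrow> real" where
  "eig_coeff n k j = fold_mult n j * cos (2 * pi * real k * real j / real n) / sqrt (real n)"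

lemma cos_fold:
  assumes "t < n"
  shows "cos (2 * pi * real k * real (min t (n - t)) / real n) = cos (2 * pi * real k * real t / real n)"
proof (cases "t \<le> n - t")
  case False
  have "2 * pi * real k * real (n - t) / real n = 2 * pi * real k - 2 * pi * real k * real t / real n"
    using assms by (simp add: of_nat_diff field_simps)
  then have "cos (2 * pi * real k * real (n - t) / real n) = cos (2 * pi * real k * real t / real n)"
    using sin_2npi[of k] cos_2npi[of k] by (simp add: cos_diff mult_ac)
  with False show ?thesis by (simp add: min_def)
qed (simp add: min_def)

lemma circ_eig_eq:
  assumes "n > 0"
  shows "circ_eig n k x = (\<Sum>j\<le>n div 2. eig_coeff n k j * x j)"
proof -
  have "circ_eig n k x = (\<Sum>t<n. x (min t (n - t)) * cos (2 * pi * real k * real (min t (n - t)) / real n)) / sqrt (real n)"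
    unfolding circ_eig_def by (simp add: cos_fold)
  also have "\<dots> = (\<Sum>j\<le>n div 2. fold_mult n j * (x j * cos (2 * pi * real k * real j / real n))) / sqrt (real n)"
    by (subst sum_fold[OF assms]) simp
  finally show ?thesis by (simp add: eig_coeff_def sum_divide_distrib mult_ac)
qed

text \<open>The double angle formula turns the squares into a character sum at frequency
  \<open>2 * k\<close>; hence the exceptional condition is \<open>n dvd 2 * k\<close> rather than
  \<open>n dvd k\<close>.\<close>

lemma sum_cos_sq:
  assumes "n > 0" "\<not> n dvd 2 * k"
  shows "(\<Sum>t<n. (cos (2 * pi * real k * real t / real n))\<^sup>2) = real n / 2"
proof -
  have "(\<Sum>t<n. (cos (2 * pi * real k * real t / real n))\<^sup>2)
      = (\<Sum>t<n. 1 / 2 + Re (unity_root n ((2 * k) * t)) / 2)"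
  proof (intro sum.cong refl)
    fix t
    have "Re (unity_root n ((2 * k) * t)) = cos (2 * (2 * pi * real k * real t / real n))"
      by (simp add: unity_root_def mult_ac)
    also have "\<dots> = 2 * (cos (2 * pi * real k * real t / real n))\<^sup>2 - 1"
      by (rule cos_double_cos)
    finally show "(cos (2 * pi * real k * real t / real n))\<^sup>2 = 1 / 2 + Re (unity_root n ((2 * k) * t)) / 2"
      by (simp add: field_simps)
  qed
  also have "\<dots> = real n / 2 + Re (\<Sum>t<n. unity_root n ((2 * k) * t)) / 2"
    by (simp only: sum.distrib Re_sum sum_divide_distrib[symmetric]) simp
  finally show ?thesis by (simp only: sum_unity_root_eq_0[OF assms]) simp
qed

lemma abs_eig_coeff_le: "\<bar>eig_coeff n k j\<bar> \<le> 2 / sqrt (real n)"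
proof -
  have "\<bar>fold_mult n j * cos (2 * pi * real k * real j / real n)\<bar> \<le> 2 * 1"
    unfolding abs_mult by (intro mult_mono) (auto simp: fold_mult_def)
  then show ?thesis by (simp add: eig_coeff_def abs_mult divide_right_mono)
qed

text \<open>For independent centred variables of unit variance this sum is the variance of the
  eigenvalue. Up to the indices counted once it equals \<open>2 * S / n\<close>, with
  \<open>S\<close> the full sum of squared cosines: 1 at ordinary frequencies, at most 2 at all of
  them.\<close>

lemma sum_eig_coeff_sq:
  assumes "n > 0"
  shows "(\<Sum>j\<le>n div 2. (eig_coeff n k j)\<^sup>2) \<le> 2"
    and "\<not> n dvd 2 * k \<Longrightarrow> \<bar>(\<Sum>j\<le>n div 2. (eig_coeff n k j)\<^sup>2) - 1\<bar> \<le> 2 / real n"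
proof -
  define c where "c j = (cos (2 * pi * real k * real j / real n))\<^sup>2" for j
  have c: "0 \<le> c j" "c j \<le> 1" for j
    by (auto simp: c_def abs_square_le_1)
  define S where "S = (\<Sum>t<n. c t)"
  have S: "S = (\<Sum>j\<le>n div 2. fold_mult n j * c j)"
  proof -
    have "S = (\<Sum>t<n. c (min t (n - t)))"
      by (simp add: S_def c_def cos_fold)
    then show ?thesis by (simp add: sum_fold[OF assms])
  qed
  \<comment> \<open>A multiplicity \<open>m\<close> satisfies
    \<open>m^2 = 2 * m - m * (2 - m)\<close>; the correction is 1 for \<open>m = 1\<close> and 0 for
    \<open>m = 2\<close>.\<close>
  define T where "T = (\<Sum>j\<le>n div 2. fold_mult n j * (2 - fold_mult n j) * c j)"
  have V: "(\<Sum>j\<le>n div 2. (eig_coeff n k j)\<^sup>2) = (2 * S - T) / real n"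
  proof -
    have "(\<Sum>j\<le>n div 2. (eig_coeff n k j)\<^sup>2) = (\<Sum>j\<le>n div 2. (fold_mult n j)\<^sup>2 * c j) / real n"
      by (simp add: eig_coeff_def c_def power_mult_distrib power_divide sum_divide_distrib)
    also have "(\<Sum>j\<le>n div 2. (fold_mult n j)\<^sup>2 * c j) = 2 * S - T"
      unfolding S T_def sum_distrib_left sum_subtractf[symmetric]
      by (intro sum.cong refl) (simp add: power2_eq_square algebra_simps)
    finally show ?thesis .
  qed
  have T0: "0 \<le> T"
    unfolding T_def by (intro sum_nonneg mult_nonneg_nonneg c) (auto simp: fold_mult_def)
  have T2: "T \<le> 2"
  proof -
    \<comment> \<open>\<open>2 * j = n\<close> forces \<open>j = n div 2\<close>; for odd
      \<open>n\<close> the second indicator is a harmless overestimate.\<close>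
    have "T \<le> (\<Sum>j\<le>n div 2. if j \<in> {0, n div 2} then 1 else 0)"
      unfolding T_def
    proof (rule sum_mono)
      fix j
      show "fold_mult n j * (2 - fold_mult n j) * c j \<le> (if j \<in> {0, n div 2} then 1 else 0)"
        using c[of j] by (auto simp: fold_mult_def)
    qed
    also have "\<dots> = (\<Sum>j\<in>{..n div 2} \<inter> {0, n div 2}. 1)"
      by (subst sum.inter_restrict[symmetric]) auto
    also have "\<dots> = real (card ({..n div 2} \<inter> {0, n div 2}))" by simp
    also have "card ({..n div 2} \<inter> {0, n div 2}) \<le> card {0, n div 2}"
      by (intro card_mono) auto
    also have "\<dots> \<le> 2" by (cases "n div 2 = 0") auto
    finally show ?thesis by simp
  qed
  have "S \<le> (\<Sum>t<n. 1)" unfolding S_def by (intro sum_mono c)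
  then have "(2 * S - T) / real n \<le> 2 * real n / real n"
    using T0 by (intro divide_right_mono) auto
  then show "(\<Sum>j\<le>n div 2. (eig_coeff n k j)\<^sup>2) \<le> 2" using V assms by simp
  assume "\<not> n dvd 2 * k"
  then have "S = real n / 2"
    unfolding S_def c_def using assms by (rule sum_cos_sq[rotated])
  then have "(2 * S - T) / real n - 1 = - T / real n"
    using assms by (simp add: field_simps)
  then show "\<bar>(\<Sum>j\<le>n div 2. (eig_coeff n k j)\<^sup>2) - 1\<bar> \<le> 2 / real n"
    unfolding V using T0 T2 assms by (simp add: divide_right_mono)
qed

subsection \<open>Gaussian moments of sums of small independent variables\<close>

text \<open>The moments of a centred Gaussian of variance \<open>v\<close>, in the form given by
  integration by parts, because sums of small variables satisfy this recursion approximately. The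
  variance is a parameter since that of an eigenvalue is only approximately 1.\<close>

fun gauss_moment :: "nat \<Rightarrow> real \<Rightarrow> real" where
  "gauss_moment 0 v = 1"
| "gauss_moment (Suc 0) v = 0"
| "gauss_moment (Suc (Suc r)) v = real (Suc r) * v * gauss_moment r v"

text \<open>Two exchanges of variances rely on this: that of a sum with one summand removed against
  that of the full sum, and that of an eigenvalue against 1.\<close>

lemma gauss_moment_lipschitz:
  assumes "0 \<le> V"
  shows "\<exists>L\<ge>0. \<forall>u\<in>{0..V}. \<forall>v\<in>{0..V}. \<bar>gauss_moment p u - gauss_moment p v\<bar> \<le> L * \<bar>u - v\<bar>"
proof (induction p rule: induct_nat_012)
  case 0
  show ?case by (intro exI[of _ 0]) auto
next
  case 1
  show ?case by (intro exI[of _ 0]) auto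
next
  case (ge2 r)
  from ge2(1) obtain L where L: "L \<ge> 0"
    "\<And>u v. u \<in> {0..V} \<Longrightarrow> v \<in> {0..V} \<Longrightarrow> \<bar>gauss_moment r u - gauss_moment r v\<bar> \<le> L * \<bar>u - v\<bar>"
    by blast
  let ?B = "\<bar>gauss_moment r 0\<bar> + L * V"
  show ?case
  proof (intro exI[of _ "real (Suc r) * (V * L + ?B)"] conjI ballI)
    show "0 \<le> real (Suc r) * (V * L + ?B)" using L(1) assms by simp
    fix u v assume uv: "u \<in> {0..V}" "v \<in> {0..V}"
    have "\<bar>gauss_moment r v\<bar> \<le> \<bar>gauss_moment r 0\<bar> + \<bar>gauss_moment r v - gauss_moment r 0\<bar>" by simp
    also have "\<bar>gauss_moment r v - gauss_moment r 0\<bar> \<le> L * \<bar>v - 0\<bar>" using uv assms by (intro L) auto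
    also have "\<dots> \<le> L * V" using uv L(1) by (intro mult_left_mono) auto
    finally have B: "\<bar>gauss_moment r v\<bar> \<le> ?B" by simp
    have "\<bar>u * gauss_moment r u - v * gauss_moment r v\<bar>
        = \<bar>u * (gauss_moment r u - gauss_moment r v) + (u - v) * gauss_moment r v\<bar>"
      by (simp add: algebra_simps)
    also have "\<dots> \<le> \<bar>u\<bar> * \<bar>gauss_moment r u - gauss_moment r v\<bar> + \<bar>u - v\<bar> * \<bar>gauss_moment r v\<bar>"
      by (metis abs_mult abs_triangle_ineq)
    also have "\<dots> \<le> V * (L * \<bar>u - v\<bar>) + \<bar>u - v\<bar> * ?B"
      using uv B L by (intro add_mono mult_mono) auto
    also have "\<dots> = (V * L + ?B) * \<bar>u - v\<bar>" by (simp add: algebra_simps)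
    finally have "real (Suc r) * \<bar>u * gauss_moment r u - v * gauss_moment r v\<bar>
        \<le> real (Suc r) * ((V * L + ?B) * \<bar>u - v\<bar>)"
      by (intro mult_left_mono) auto
    moreover have "\<bar>gauss_moment (Suc (Suc r)) u - gauss_moment (Suc (Suc r)) v\<bar>
        = real (Suc r) * \<bar>u * gauss_moment r u - v * gauss_moment r v\<bar>"
      by (simp only: gauss_moment.simps mult.assoc right_diff_distrib[symmetric] abs_mult abs_of_nat)
    ultimately show "\<bar>gauss_moment (Suc (Suc r)) u - gauss_moment (Suc (Suc r)) v\<bar>
        \<le> real (Suc r) * (V * L + ?B) * \<bar>u - v\<bar>"
      by (simp only: mult.assoc)
  qed
qed

lemma gauss_moment_bounded:
  assumes "0 \<le> V"
  shows "\<exists>G\<ge>0. \<forall>v\<in>{0..V}. \<bar>gauss_moment p v\<bar> \<le> G"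
proof -
  obtain L where L: "L \<ge> 0"
    "\<And>u v. u \<in> {0..V} \<Longrightarrow> v \<in> {0..V} \<Longrightarrow> \<bar>gauss_moment p u - gauss_moment p v\<bar> \<le> L * \<bar>u - v\<bar>"
    using gauss_moment_lipschitz[OF assms] by blast
  show ?thesis
  proof (intro exI[of _ "\<bar>gauss_moment p 0\<bar> + L * V"] conjI ballI)
    show "0 \<le> \<bar>gauss_moment p 0\<bar> + L * V" using L(1) assms by simp
    fix v assume v: "v \<in> {0..V}"
    then have "\<bar>gauss_moment p v - gauss_moment p 0\<bar> \<le> L * \<bar>v - 0\<bar>" using assms by (intro L) auto
    also have "\<dots> \<le> L * V" using v L(1) by (intro mult_left_mono) auto
    finally show "\<bar>gauss_moment p v\<bar> \<le> \<bar>gauss_moment p 0\<bar> + L * V" by simp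
  qed
qed

section \<open>Separating one summand and the moment recursion\<close>

context prob_space
begin

text \<open>The case \<open>a = 0\<close> carries integrability through an induction over the
  summands; \<open>a = 1\<close> separates one summand in the moment recursion.\<close>

lemma
  fixes U T :: "'a \<Rightarrow> real"
  assumes ind: "indep_var borel U borel T"
    and U: "\<And>q. integrable M (\<lambda>\<omega>. U \<omega> ^ q)" and T: "\<And>q. integrable M (\<lambda>\<omega>. T \<omega> ^ q)"
  shows integrable_mult_power_add_indep: "integrable M (\<lambda>\<omega>. U \<omega> ^ a * (U \<omega> + T \<omega>) ^ p)"
    and expectation_mult_power_add_indep:
      "expectation (\<lambda>\<omega>. U \<omega> ^ a * (U \<omega> + T \<omega>) ^ p)
        = (\<Sum>q\<le>p. real (p choose q) * expectation (\<lambda>\<omega>. U \<omega> ^ (q + a)) * expectation (\<lambda>\<omega>. T \<omega> ^ (p - q)))"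
proof -
  have eq: "(\<lambda>\<omega>. U \<omega> ^ a * (U \<omega> + T \<omega>) ^ p)
      = (\<lambda>\<omega>. \<Sum>q\<le>p. real (p choose q) * (U \<omega> ^ (q + a) * T \<omega> ^ (p - q)))"
    by (simp add: binomial_ring sum_distrib_left power_add mult_ac)
  have ip: "indep_var borel (\<lambda>\<omega>. U \<omega> ^ k) borel (\<lambda>\<omega>. T \<omega> ^ l)" for k l
    using indep_var_compose[OF ind, of "\<lambda>x. x ^ k" borel "\<lambda>x. x ^ l" borel] by (simp add: comp_def)
  note int = indep_var_integrable[OF ip U T]
  show "integrable M (\<lambda>\<omega>. U \<omega> ^ a * (U \<omega> + T \<omega>) ^ p)"
    unfolding eq by (intro Bochner_Integration.integrable_sum integrable_mult_right int)
  show "expectation (\<lambda>\<omega>. U \<omega> ^ a * (U \<omega> + T \<omega>) ^ p)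
      = (\<Sum>q\<le>p. real (p choose q) * expectation (\<lambda>\<omega>. U \<omega> ^ (q + a)) * expectation (\<lambda>\<omega>. T \<omega> ^ (p - q)))"
    unfolding eq
    by (simp only: Bochner_Integration.integral_sum[OF integrable_mult_right[OF int]]
          integral_mult_right_zero indep_var_lebesgue_integral[OF ip U T] mult.assoc)
qed

lemma integrable_power_sum_indep:
  fixes Y :: "'i \<Rightarrow> 'a \<Rightarrow> real"
  assumes "finite J" "indep_vars (\<lambda>_. borel) Y J" "\<And>j q. j \<in> J \<Longrightarrow> integrable M (\<lambda>\<omega>. Y j \<omega> ^ q)"
  shows "integrable M (\<lambda>\<omega>. (\<Sum>j\<in>J. Y j \<omega>) ^ p)"
  using assms
proof (induction J arbitrary: p rule: finite_induct)
  case empty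
  then show ?case by simp
next
  case (insert j J)
  have "integrable M (\<lambda>\<omega>. (\<Sum>j\<in>J. Y j \<omega>) ^ q)" for q
    using insert.prems by (intro insert.IH indep_vars_subset[OF insert.prems(1)]) auto
  moreover have "indep_var borel (Y j) borel (\<lambda>\<omega>. \<Sum>j\<in>J. Y j \<omega>)"
    using insert by (intro indep_vars_sum) auto
  ultimately have "integrable M (\<lambda>\<omega>. Y j \<omega> ^ 0 * (Y j \<omega> + (\<Sum>j\<in>J. Y j \<omega>)) ^ p)"
    using insert.prems by (intro integrable_mult_power_add_indep) auto
  then show ?case using insert by simp
qed

text \<open>One number \<open>\<delta>\<close> controls both the single variances and the higher
  moments relative to them. The factor \<open>s j\<close> in the moment bound is essential: summed
  over \<open>j\<close> it gives the total variance, however many summands there are. Removing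
  indices keeps \<open>K\<close> and \<open>\<delta>\<close>, so constants found by induction apply
  to reduced sums.\<close>

definition small_array :: "(nat \<Rightarrow> real) \<Rightarrow> real \<Rightarrow> ('i \<Rightarrow> real) \<Rightarrow> ('i \<Rightarrow> 'a \<Rightarrow> real) \<Rightarrow> 'i set \<Rightarrow> bool" where
  "small_array K \<delta> s Y J \<longleftrightarrow> finite J \<and> 0 \<le> \<delta> \<and> \<delta> \<le> 1 \<and> indep_vars (\<lambda>_. borel) Y J \<and>
    (\<forall>j\<in>J. (\<forall>q. integrable M (\<lambda>\<omega>. Y j \<omega> ^ q)) \<and> expectation (Y j) = 0 \<and>
      expectation (\<lambda>\<omega>. (Y j \<omega>)\<^sup>2) = s j \<and> 0 \<le> s j \<and> s j \<le> \<delta> \<and>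
      (\<forall>q\<ge>3. \<bar>expectation (\<lambda>\<omega>. Y j \<omega> ^ q)\<bar> \<le> K q * \<delta> * s j))"

lemma small_array_subset: "small_array K \<delta> s Y J \<Longrightarrow> I \<subseteq> J \<Longrightarrow> small_array K \<delta> s Y I"
  using finite_subset[of I J] indep_vars_subset[of _ Y J I] unfolding small_array_def
  by (meson subsetD)

text \<open>The recursion is the one of Stein's method: expanding one factor of \<open>S ^ (r + 2)\<close> as
  \<open>S = (\<Sum>j. Y j)\<close> and separating \<open>Y j\<close> from the remaining sum reproduces
  the moment recursion of the Gaussian up to terms of third order in \<open>Y j\<close>.\<close>

lemma moment_small_array:
  fixes K :: "nat \<Rightarrow> real"
  assumes V: "0 \<le> V" and K: "\<And>q. 0 \<le> K q"
  shows "\<exists>C\<ge>0. \<forall>J (Y :: 'i \<Rightarrow> 'a \<Rightarrow> real) s \<delta>. small_array K \<delta> s Y J \<longrightarrow> sum s J \<le> V \<longrightarrow>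
    \<bar>expectation (\<lambda>\<omega>. (\<Sum>j\<in>J. Y j \<omega>) ^ p) - gauss_moment p (sum s J)\<bar> \<le> C * \<delta>"
proof (induction p rule: less_induct)
  case (less p)
  consider "p = 0" | "p = Suc 0" | r where "p = Suc (Suc r)"
    by (metis not0_implies_Suc)
  then show ?case
  proof cases
    case 1
    then show ?thesis by (intro exI[of _ 0]) (auto simp: prob_space)
  next
    case 2
    have "expectation (\<lambda>\<omega>. \<Sum>j\<in>J. Y j \<omega>) = 0" if "small_array K \<delta> s Y J"
      for J and Y :: "'i \<Rightarrow> 'a \<Rightarrow> real" and s \<delta>
    proof -
      have int: "integrable M (Y j)" if "j \<in> J" for j
        using \<open>small_array K \<delta> s Y J\<close> that unfolding small_array_def
        by (metis (no_types, lifting) Bochner_Integration.integrable_cong power_one_right)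
      have "expectation (\<lambda>\<omega>. \<Sum>j\<in>J. Y j \<omega>) = (\<Sum>j\<in>J. expectation (Y j))"
        by (intro Bochner_Integration.integral_sum int)
      also have "\<dots> = 0" using that by (intro sum.neutral) (auto simp: small_array_def)
      finally show ?thesis .
    qed
    with 2 show ?thesis by (intro exI[of _ 0]) auto
  next
    case (3 r)
    \<comment> \<open>The guard \<open>l < p\<close> is placed inside so that one choice function
      collects the constants of all lower orders.\<close>
    have "\<forall>l. \<exists>C. l < p \<longrightarrow> C \<ge> 0 \<and> (\<forall>J (Y :: 'i \<Rightarrow> 'a \<Rightarrow> real) s \<delta>. small_array K \<delta> s Y J \<longrightarrow> sum s J \<le> V \<longrightarrow>
        \<bar>expectation (\<lambda>\<omega>. (\<Sum>j\<in>J. Y j \<omega>) ^ l) - gauss_moment l (sum s J)\<bar> \<le> C * \<delta>)"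
      using less.IH by blast
    then obtain C where C: "\<And>l. l < p \<Longrightarrow> C l \<ge> 0"
      "\<And>l J (Y :: 'i \<Rightarrow> 'a \<Rightarrow> real) s \<delta>. l < p \<Longrightarrow> small_array K \<delta> s Y J \<Longrightarrow> sum s J \<le> V \<Longrightarrow>
        \<bar>expectation (\<lambda>\<omega>. (\<Sum>j\<in>J. Y j \<omega>) ^ l) - gauss_moment l (sum s J)\<bar> \<le> C l * \<delta>"
      by metis
    obtain G where G: "\<And>l. G l \<ge> 0" "\<And>l v. v \<in> {0..V} \<Longrightarrow> \<bar>gauss_moment l v\<bar> \<le> G l"
      using gauss_moment_bounded[OF V] by metis
    obtain L where L: "L \<ge> 0"
      "\<And>u v. u \<in> {0..V} \<Longrightarrow> v \<in> {0..V} \<Longrightarrow> \<bar>gauss_moment r u - gauss_moment r v\<bar> \<le> L * \<bar>u - v\<bar>"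
      using gauss_moment_lipschitz[OF V] by blast
    \<comment> \<open>\<open>B l\<close> adds the approximation error, with
      \<open>\<delta> \<le> 1\<close>, to the Gaussian bound. In \<open>D\<close> the index
      \<open>i\<close> stands for the binomial term \<open>q = i + 2\<close>, with order
      \<open>i + 3\<close> for the separated variable and \<open>r - Suc i\<close> for the rest.
      \<open>E\<close> adds the error of the term \<open>q = 1\<close>.\<close>
    define B where "B l = C l + G l" for l
    define D where "D = (\<Sum>i<r. real (Suc r choose Suc (Suc i)) * K (i + 3) * B (r - Suc i))"
    define E where "E = real (Suc r) * (C r + L) + D"
    have B0: "l < p \<Longrightarrow> 0 \<le> B l" for l using C(1) G(1) by (simp add: B_def)
    have D0: "0 \<le> D" unfolding D_def using 3 by (intro sum_nonneg mult_nonneg_nonneg K B0) auto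
    have E0: "0 \<le> E" unfolding E_def using D0 L(1) C(1)[of r] 3 by simp
    have main: "\<bar>expectation (\<lambda>\<omega>. (\<Sum>j\<in>J. Y j \<omega>) ^ p) - gauss_moment p (sum s J)\<bar> \<le> V * E * \<delta>"
      if A: "small_array K \<delta> s Y J" and sV: "sum s J \<le> V"
      for J and Y :: "'i \<Rightarrow> 'a \<Rightarrow> real" and s \<delta>
    proof -
      define S where "S \<omega> = (\<Sum>j\<in>J. Y j \<omega>)" for \<omega>
      define T where "T j \<omega> = (\<Sum>i\<in>J - {j}. Y i \<omega>)" for j \<omega>
      from A have fin: "finite J" and \<delta>: "0 \<le> \<delta>" "\<delta> \<le> 1" and ind: "indep_vars (\<lambda>_. borel) Y J"
        and Yint: "\<And>j q. j \<in> J \<Longrightarrow> integrable M (\<lambda>\<omega>. Y j \<omega> ^ q)"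
        and Y1: "\<And>j. j \<in> J \<Longrightarrow> expectation (Y j) = 0"
        and Y2: "\<And>j. j \<in> J \<Longrightarrow> expectation (\<lambda>\<omega>. (Y j \<omega>)\<^sup>2) = s j"
        and s: "\<And>j. j \<in> J \<Longrightarrow> 0 \<le> s j" "\<And>j. j \<in> J \<Longrightarrow> s j \<le> \<delta>"
        and YK: "\<And>j q. j \<in> J \<Longrightarrow> q \<ge> 3 \<Longrightarrow> \<bar>expectation (\<lambda>\<omega>. Y j \<omega> ^ q)\<bar> \<le> K q * \<delta> * s j"
        unfolding small_array_def by auto
      have sum0: "0 \<le> sum s J" using s by (intro sum_nonneg) auto
      have S_eq: "S \<omega> = Y j \<omega> + T j \<omega>" if "j \<in> J" for j \<omega>
        unfolding S_def T_def using fin that by (rule sum.remove)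
      have TA: "small_array K \<delta> s Y (J - {j})" for j
        using A by (rule small_array_subset) auto
      have sT: "sum s (J - {j}) = sum s J - s j" if "j \<in> J" for j
        using fin that by (simp add: sum_diff1)
      have sT0: "0 \<le> sum s (J - {j})" for j
        using s(1) by (intro sum_nonneg) auto
      have sTV: "0 \<le> sum s (J - {j})" "sum s (J - {j}) \<le> V" if "j \<in> J" for j
        using sT0[of j] s(1)[OF that] sV sT[OF that] by linarith+
      have Tint: "integrable M (\<lambda>\<omega>. T j \<omega> ^ q)" for j q
        unfolding T_def using fin Yint
        by (intro integrable_power_sum_indep indep_vars_subset[OF ind]) auto
      have YT: "indep_var borel (Y j) borel (T j)" if "j \<in> J" for j
      proof -
        have "indep_var borel (Y j) borel (\<lambda>\<omega>. \<Sum>i\<in>J - {j}. Y i \<omega>)"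
          using fin ind that by (intro indep_vars_sum) (auto simp: insert_absorb)
        then show ?thesis by (simp add: T_def[abs_def])
      qed
      have TB: "\<bar>expectation (\<lambda>\<omega>. T j \<omega> ^ l)\<bar> \<le> B l" if "j \<in> J" "l < p" for j l
      proof -
        have "\<bar>expectation (\<lambda>\<omega>. T j \<omega> ^ l) - gauss_moment l (sum s (J - {j}))\<bar> \<le> C l * \<delta>"
          unfolding T_def using that by (intro C(2) TA sTV)
        also have "\<dots> \<le> C l * 1" using C(1)[OF that(2)] \<delta> by (intro mult_left_mono)
        finally show ?thesis
          using G(2)[of "sum s (J - {j})" l] sTV[OF that(1)] by (simp add: B_def)
      qed
      \<comment> \<open>Removing \<open>j\<close> lowers the variance by
        \<open>s j \<le> \<delta>\<close>, which the Lipschitz constant converts into an error of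
        order \<open>\<delta>\<close>.\<close>
      have Tr: "\<bar>expectation (\<lambda>\<omega>. T j \<omega> ^ r) - gauss_moment r (sum s J)\<bar> \<le> (C r + L) * \<delta>" if "j \<in> J" for j
      proof -
        have "\<bar>expectation (\<lambda>\<omega>. T j \<omega> ^ r) - gauss_moment r (sum s (J - {j}))\<bar> \<le> C r * \<delta>"
          unfolding T_def using that 3 by (intro C(2) TA sTV) auto
        moreover have "\<bar>gauss_moment r (sum s (J - {j})) - gauss_moment r (sum s J)\<bar>
            \<le> L * \<bar>sum s (J - {j}) - sum s J\<bar>"
          using sTV[OF that] sum0 sV by (intro L) auto
        moreover have "L * \<bar>sum s (J - {j}) - sum s J\<bar> \<le> L * \<delta>"
          using s[OF that] L(1) by (intro mult_left_mono) (auto simp: sT[OF that])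
        ultimately show ?thesis by (simp add: distrib_right)
      qed
      define e where "e j = expectation (\<lambda>\<omega>. Y j \<omega> * S \<omega> ^ Suc r)" for j
      have eint: "integrable M (\<lambda>\<omega>. Y j \<omega> * S \<omega> ^ Suc r)" if "j \<in> J" for j
        using integrable_mult_power_add_indep[OF YT[OF that] Yint[OF that] Tint, of 1 "Suc r"]
        by (simp only: S_eq[OF that] power_one_right)
      have e: "\<bar>e j - real (Suc r) * s j * gauss_moment r (sum s J)\<bar> \<le> s j * (E * \<delta>)" if j: "j \<in> J" for j
      proof -
        define h where "h q = real (Suc r choose q) * expectation (\<lambda>\<omega>. Y j \<omega> ^ (q + 1))
            * expectation (\<lambda>\<omega>. T j \<omega> ^ (Suc r - q))" for q
        have "e j = (\<Sum>q\<le>Suc r. h q)"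
          using expectation_mult_power_add_indep[OF YT[OF j] Yint[OF j] Tint, of 1 "Suc r"]
          by (simp only: e_def S_eq[OF j] power_one_right h_def)
        \<comment> \<open>The term \<open>q = 0\<close> vanishes by the zero mean,
          \<open>q = 1\<close> carries the variance and yields the Gaussian recursion, and all
          others contain a moment of order at least 3.\<close>
        also have "\<dots> = h 0 + (h 1 + (\<Sum>i<r. h (Suc (Suc i))))"
          by (simp only: lessThan_Suc_atMost[symmetric] sum.lessThan_Suc_shift One_nat_def)
        also have "h 0 = 0" using Y1[OF j] by (simp add: h_def)
        also have "h 1 = real (Suc r) * s j * expectation (\<lambda>\<omega>. T j \<omega> ^ r)"
          using Y2[OF j] by (simp add: h_def power2_eq_square)
        finally have ej: "e j - real (Suc r) * s j * gauss_moment r (sum s J)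
            = real (Suc r) * s j * (expectation (\<lambda>\<omega>. T j \<omega> ^ r) - gauss_moment r (sum s J))
              + (\<Sum>i<r. h (Suc (Suc i)))"
          by (simp add: algebra_simps)
        have "\<bar>h (Suc (Suc i))\<bar> \<le> real (Suc r choose Suc (Suc i)) * K (i + 3) * B (r - Suc i) * (\<delta> * s j)"
          if "i < r" for i
        proof -
          have "\<bar>h (Suc (Suc i))\<bar> = real (Suc r choose Suc (Suc i)) * \<bar>expectation (\<lambda>\<omega>. Y j \<omega> ^ (i + 3))\<bar>
              * \<bar>expectation (\<lambda>\<omega>. T j \<omega> ^ (r - Suc i))\<bar>"
            by (simp add: h_def abs_mult numeral_3_eq_3 del: binomial_Suc_Suc)
          also have "\<dots> \<le> real (Suc r choose Suc (Suc i)) * (K (i + 3) * \<delta> * s j) * B (r - Suc i)"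
            using that 3 j \<delta> s K by (intro mult_mono TB YK mult_nonneg_nonneg) auto
          finally show ?thesis by (simp only: mult_ac)
        qed
        then have "\<bar>\<Sum>i<r. h (Suc (Suc i))\<bar> \<le> D * (\<delta> * s j)"
          unfolding D_def sum_distrib_right by (intro order_trans[OF sum_abs] sum_mono) auto
        moreover have "\<bar>real (Suc r) * s j * (expectation (\<lambda>\<omega>. T j \<omega> ^ r) - gauss_moment r (sum s J))\<bar>
            \<le> real (Suc r) * s j * ((C r + L) * \<delta>)"
          unfolding abs_mult using s(1)[OF j] Tr[OF j] by (intro mult_mono) auto
        ultimately have "\<bar>e j - real (Suc r) * s j * gauss_moment r (sum s J)\<bar>
            \<le> real (Suc r) * s j * ((C r + L) * \<delta>) + D * (\<delta> * s j)"
          unfolding ej by linarith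
        also have "\<dots> = s j * (E * \<delta>)" by (simp add: E_def algebra_simps)
        finally show ?thesis .
      qed
      have "expectation (\<lambda>\<omega>. S \<omega> ^ p) = expectation (\<lambda>\<omega>. \<Sum>j\<in>J. Y j \<omega> * S \<omega> ^ Suc r)"
        by (simp add: 3 sum_distrib_right[symmetric] S_def[symmetric])
      also have "\<dots> = (\<Sum>j\<in>J. e j)"
        unfolding e_def by (intro Bochner_Integration.integral_sum eint)
      finally have "\<bar>expectation (\<lambda>\<omega>. S \<omega> ^ p) - gauss_moment p (sum s J)\<bar>
          = \<bar>\<Sum>j\<in>J. e j - real (Suc r) * s j * gauss_moment r (sum s J)\<bar>"
        by (simp add: 3 sum_subtractf sum_distrib_left sum_distrib_right)
      \<comment> \<open>Every single error keeps the factor \<open>s j\<close>, so the total is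
        governed by \<open>V\<close>, independently of the size of \<open>J\<close>.\<close>
      also have "\<dots> \<le> (\<Sum>j\<in>J. s j * (E * \<delta>))"
        by (intro order_trans[OF sum_abs] sum_mono e)
      also have "\<dots> = sum s J * (E * \<delta>)" by (simp add: sum_distrib_right)
      also have "\<dots> \<le> V * (E * \<delta>)" using E0 \<delta> sV by (intro mult_right_mono) auto
      finally show ?thesis by (simp add: S_def mult.assoc)
    qed
    show ?thesis using V E0 main by (intro exI[of _ "V * E"]) auto
  qed
qed

end

subsection \<open>Moments of the eigenvalues and of words\<close>

context prob_space
begin

lemma integrable_power_of_moment_bound:
  fixes X :: "'a \<Rightarrow> real"
  assumes rv: "X \<in> borel_measurable M" and var: "expectation (\<lambda>\<omega>. (X \<omega>)\<^sup>2) = 1"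
    and mom: "\<And>k. k \<ge> 3 \<Longrightarrow> (\<integral>\<^sup>+ \<omega>. ennreal (\<bar>X \<omega>\<bar> ^ k) \<partial>M) < \<infinity>"
  shows "integrable M (\<lambda>\<omega>. X \<omega> ^ q)"
proof -
  \<comment> \<open>A function that is not integrable has Bochner integral 0, so the value 1 forces
    integrability.\<close>
  have sq: "integrable M (\<lambda>\<omega>. (X \<omega>)\<^sup>2)"
    using var not_integrable_integral_eq by fastforce
  consider "q = 0" | "q = 1" | "q = 2" | "q \<ge> 3" by linarith
  then show ?thesis
  proof cases
    case 2
    then show ?thesis using square_integrable_imp_integrable[OF rv sq] by simp
  next
    case 4
    show ?thesis
      using rv mom[OF 4] by (intro integrableI_bounded) (auto simp: power_abs)
  qed (use sq in auto)
qed

lemma abs_moment_le: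
  fixes X :: "'a \<Rightarrow> real"
  assumes int: "integrable M (\<lambda>\<omega>. X \<omega> ^ q)"
    and le: "(\<integral>\<^sup>+ \<omega>. ennreal (\<bar>X \<omega>\<bar> ^ q) \<partial>M) \<le> S" and "S < \<infinity>"
  shows "\<bar>expectation (\<lambda>\<omega>. X \<omega> ^ q)\<bar> \<le> enn2real S"
proof -
  have "\<bar>expectation (\<lambda>\<omega>. X \<omega> ^ q)\<bar> \<le> expectation (\<lambda>\<omega>. \<bar>X \<omega> ^ q\<bar>)"
    by (rule integral_abs_bound)
  also have "ennreal \<dots> = (\<integral>\<^sup>+ \<omega>. ennreal (\<bar>X \<omega> ^ q\<bar>) \<partial>M)"
    using int by (intro nn_integral_eq_integral[symmetric]) auto
  then have "enn2real (ennreal (expectation (\<lambda>\<omega>. \<bar>X \<omega> ^ q\<bar>))) \<le> enn2real S"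
    using le \<open>S < \<infinity>\<close> by (intro enn2real_mono) (auto simp: power_abs)
  then have "expectation (\<lambda>\<omega>. \<bar>X \<omega> ^ q\<bar>) \<le> enn2real S" by simp
  finally show ?thesis .
qed

lemma small_array_weighted:
  fixes X :: "'i \<Rightarrow> 'a \<Rightarrow> real"
  assumes "finite J" "0 \<le> \<delta>" "\<delta> \<le> 1"
    and ind: "indep_vars (\<lambda>_. borel) X J"
    and int: "\<And>j q. j \<in> J \<Longrightarrow> integrable M (\<lambda>\<omega>. X j \<omega> ^ q)"
    and mean: "\<And>j. j \<in> J \<Longrightarrow> expectation (X j) = 0"
    and var: "\<And>j. j \<in> J \<Longrightarrow> expectation (\<lambda>\<omega>. (X j \<omega>)\<^sup>2) = 1"
    and K: "\<And>j q. j \<in> J \<Longrightarrow> q \<ge> 3 \<Longrightarrow> \<bar>expectation (\<lambda>\<omega>. X j \<omega> ^ q)\<bar> \<le> K q"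
    and a: "\<And>j. j \<in> J \<Longrightarrow> \<bar>a j\<bar> \<le> \<delta>"
  shows "small_array K \<delta> (\<lambda>j. (a j)\<^sup>2) (\<lambda>j \<omega>. a j * X j \<omega>) J"
proof -
  have "indep_vars (\<lambda>_. borel) (\<lambda>j \<omega>. a j * X j \<omega>) J"
    using indep_vars_compose2[OF ind, of "\<lambda>j x. a j * x" "\<lambda>_. borel"] by simp
  moreover have "(a j)\<^sup>2 \<le> \<delta>" if "j \<in> J" for j
  proof -
    have "\<bar>a j\<bar> * \<bar>a j\<bar> \<le> \<delta> * 1" using a[OF that] assms(3) by (intro mult_mono) auto
    then show ?thesis by (simp add: power2_eq_square)
  qed
  moreover have "\<bar>expectation (\<lambda>\<omega>. (a j * X j \<omega>) ^ q)\<bar> \<le> K q * \<delta> * (a j)\<^sup>2"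
    if j: "j \<in> J" and q: "q \<ge> 3" for j q
  proof -
    have a1: "\<bar>a j\<bar> \<le> 1" using a[OF j] assms(3) by simp
    obtain l where l: "q = l + 3" using q by (metis add.commute le_Suc_ex)
    \<comment> \<open>Order \<open>q \<ge> 3\<close> leaves a spare factor beyond the square: it
      supplies \<open>\<delta>\<close>, the square is the variance, and the remaining powers are at
      most 1.\<close>
    have "\<bar>a j\<bar> ^ q = \<bar>a j\<bar> ^ l * \<bar>a j\<bar> * (a j)\<^sup>2"
      by (simp add: l power_add power2_eq_square power3_eq_cube)
    also have "\<dots> \<le> 1 * \<delta> * (a j)\<^sup>2"
      using a[OF j] a1 by (intro mult_mono power_le_one) auto
    finally have "\<bar>a j\<bar> ^ q * \<bar>expectation (\<lambda>\<omega>. X j \<omega> ^ q)\<bar> \<le> (\<delta> * (a j)\<^sup>2) * K q"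
      using K[OF j q] assms(2) by (intro mult_mono) auto
    then show ?thesis by (simp add: power_mult_distrib abs_mult power_abs mult_ac)
  qed
  ultimately show ?thesis
    using assms by (simp add: small_array_def power_mult_distrib)
qed

text \<open>The weights \<open>eig_coeff n k j\<close> form a small array of total variance at most
  2 with smallness \<open>2 / sqrt n\<close>, which is at most 1 from \<open>n = 4\<close> on. The
  constants come from \<open>K\<close> and \<open>p\<close> alone, whence the uniformity in
  \<open>n\<close> and \<open>k\<close>.\<close>

lemma circ_eig_moments:
  fixes X :: "nat \<Rightarrow> 'a \<Rightarrow> real"
  assumes ind: "indep_vars (\<lambda>_. borel) X UNIV"
    and mean: "\<And>j. expectation (X j) = 0"
    and var: "\<And>j. expectation (\<lambda>\<omega>. (X j \<omega>)\<^sup>2) = 1"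
    and int: "\<And>j q. integrable M (\<lambda>\<omega>. X j \<omega> ^ q)"
    and K: "\<And>j q. q \<ge> 3 \<Longrightarrow> \<bar>expectation (\<lambda>\<omega>. X j \<omega> ^ q)\<bar> \<le> K q" "\<And>q. 0 \<le> K q"
  shows "n > 0 \<Longrightarrow> integrable M (\<lambda>\<omega>. circ_eig n k (\<lambda>j. X j \<omega>) ^ p)"
    and "\<exists>C\<ge>0. \<forall>n k. n \<ge> 4 \<longrightarrow>
      \<bar>expectation (\<lambda>\<omega>. circ_eig n k (\<lambda>j. X j \<omega>) ^ p)\<bar> \<le> C \<and>
      (\<not> n dvd 2 * k \<longrightarrow> \<bar>expectation (\<lambda>\<omega>. circ_eig n k (\<lambda>j. X j \<omega>) ^ p) - gauss_moment p 1\<bar> \<le> C * (1 / sqrt n))"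
proof -
  assume "n > 0"
  have "indep_vars (\<lambda>_. borel) (\<lambda>j \<omega>. eig_coeff n k j * X j \<omega>) {..n div 2}"
    using indep_vars_compose2[OF indep_vars_subset[OF ind], of "{..n div 2}" "\<lambda>j x. eig_coeff n k j * x" "\<lambda>_. borel"] by simp
  then show "integrable M (\<lambda>\<omega>. circ_eig n k (\<lambda>j. X j \<omega>) ^ p)"
    unfolding circ_eig_eq[OF \<open>n > 0\<close>]
    by (intro integrable_power_sum_indep) (auto simp: power_mult_distrib int)
next
  obtain C where C: "C \<ge> 0"
    "\<And>J (Y :: nat \<Rightarrow> 'a \<Rightarrow> real) s \<delta>. small_array K \<delta> s Y J \<Longrightarrow> sum s J \<le> 2 \<Longrightarrow>
      \<bar>expectation (\<lambda>\<omega>. (\<Sum>j\<in>J. Y j \<omega>) ^ p) - gauss_moment p (sum s J)\<bar> \<le> C * \<delta>"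
    using moment_small_array[of 2 K p] K(2) by auto
  obtain G where G: "G \<ge> 0" "\<And>v. v \<in> {0..2} \<Longrightarrow> \<bar>gauss_moment p v\<bar> \<le> G"
    using gauss_moment_bounded[of 2 p] by auto
  obtain L where L: "L \<ge> 0"
    "\<And>u v. u \<in> {0..2} \<Longrightarrow> v \<in> {0..2} \<Longrightarrow> \<bar>gauss_moment p u - gauss_moment p v\<bar> \<le> L * \<bar>u - v\<bar>"
    using gauss_moment_lipschitz[of 2 p] by auto
  show "\<exists>C\<ge>0. \<forall>n k. n \<ge> 4 \<longrightarrow>
      \<bar>expectation (\<lambda>\<omega>. circ_eig n k (\<lambda>j. X j \<omega>) ^ p)\<bar> \<le> C \<and>
      (\<not> n dvd 2 * k \<longrightarrow> \<bar>expectation (\<lambda>\<omega>. circ_eig n k (\<lambda>j. X j \<omega>) ^ p) - gauss_moment p 1\<bar> \<le> C * (1 / sqrt n))"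
  \<comment> \<open>\<open>C\<close> is doubled because the smallness is \<open>2 / sqrt n\<close>,
    \<open>L\<close> because the variance error \<open>2 / n\<close> is at most the same number;
    \<open>G\<close> bounds Gaussian moments for variances up to 2. One constant serves both
    estimates.\<close>
  proof (intro exI[of _ "2 * C + 2 * L + G"] conjI allI impI)
    show "0 \<le> 2 * C + 2 * L + G" using C(1) L(1) G(1) by simp
    fix n k :: nat assume n: "n \<ge> 4"
    define v where "v = (\<Sum>j\<le>n div 2. (eig_coeff n k j)\<^sup>2)"
    define \<mu> where "\<mu> = expectation (\<lambda>\<omega>. circ_eig n k (\<lambda>j. X j \<omega>) ^ p)"
    define \<delta> where "\<delta> = 2 / sqrt (real n)"
    have "2 \<le> sqrt (real n)" using n by (intro real_le_rsqrt) auto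
    then have \<delta>: "0 \<le> \<delta>" "\<delta> \<le> 1" using n by (auto simp: \<delta>_def divide_le_eq_1_pos)
    have "small_array K \<delta> (\<lambda>j. (eig_coeff n k j)\<^sup>2) (\<lambda>j \<omega>. eig_coeff n k j * X j \<omega>) {..n div 2}"
      using \<delta> K(1) abs_eig_coeff_le
      by (intro small_array_weighted indep_vars_subset[OF ind] int mean var) (auto simp: \<delta>_def)
    moreover have v2: "v \<in> {0..2}"
      using sum_eig_coeff_sq(1)[of n k] n by (auto simp: v_def intro: sum_nonneg)
    ultimately have \<mu>: "\<bar>\<mu> - gauss_moment p v\<bar> \<le> C * \<delta>"
      using C(2)[of \<delta> "\<lambda>j. (eig_coeff n k j)\<^sup>2" "\<lambda>j \<omega>. eig_coeff n k j * X j \<omega>" "{..n div 2}"] n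
      by (simp add: v_def \<mu>_def circ_eig_eq)
    have "C * \<delta> \<le> C * 1" using C(1) \<delta> by (intro mult_left_mono)
    then show "\<bar>\<mu>\<bar> \<le> 2 * C + 2 * L + G"
      using \<mu> G(2)[OF v2] C(1) L(1) by linarith
    assume "\<not> n dvd 2 * k"
    then have "\<bar>v - 1\<bar> \<le> 2 / real n"
      unfolding v_def using n by (intro sum_eig_coeff_sq(2)) auto
    also have "\<dots> \<le> 2 / sqrt (real n)"
    proof (rule divide_left_mono)
      have "sqrt (real n) * 1 \<le> sqrt (real n) * sqrt (real n)" using n by (intro mult_left_mono) auto
      then show "sqrt (real n) \<le> real n" by simp
    qed (use n in auto)
    finally have "L * \<bar>v - 1\<bar> \<le> L * \<delta>" unfolding \<delta>_def by (intro mult_left_mono L(1))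
    moreover have "\<bar>gauss_moment p v - gauss_moment p 1\<bar> \<le> L * \<bar>v - 1\<bar>"
      using v2 by (intro L(2)) auto
    ultimately have "\<bar>\<mu> - gauss_moment p 1\<bar> \<le> (C + L) * \<delta>"
      using \<mu> by (simp add: distrib_right)
    also have "\<dots> = (2 * C + 2 * L) * (1 / sqrt n)" by (simp add: \<delta>_def)
    also have "\<dots> \<le> (2 * C + 2 * L + G) * (1 / sqrt n)" using G(1) by (intro mult_right_mono) auto
    finally show "\<bar>\<mu> - gauss_moment p 1\<bar> \<le> (2 * C + 2 * L + G) * (1 / sqrt n)" .
  qed
qed

end

section \<open>Words in independent variables and averaging over frequencies\<close>

lemma prod_list_map_eq_prod_count:
  fixes f :: "'i \<Rightarrow> 'c :: comm_monoid_mult"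
  assumes "finite I" "set w \<subseteq> I"
  shows "(\<Prod>i\<leftarrow>w. f i) = (\<Prod>i\<in>I. f i ^ count_list w i)"
  using assms(2)
proof (induction w)
  case (Cons x w)
  then have x: "x \<in> I" by simp
  have "(\<Prod>i\<in>I - {x}. f i ^ count_list (x # w) i) = (\<Prod>i\<in>I - {x}. f i ^ count_list w i)"
    by (rule prod.cong) auto
  then have "(\<Prod>i\<in>I. f i ^ count_list (x # w) i)
      = f x ^ Suc (count_list w x) * (\<Prod>i\<in>I - {x}. f i ^ count_list w i)"
    by (simp add: prod.remove[OF assms(1) x])
  also have "\<dots> = f x * (\<Prod>i\<in>I. f i ^ count_list w i)"
    by (simp add: prod.remove[OF assms(1) x, of "\<lambda>i. f i ^ count_list w i"] mult.assoc)
  finally show ?case using Cons by simp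
qed simp

lemma (in prob_space)
  fixes Z :: "'i \<Rightarrow> 'a \<Rightarrow> real"
  assumes I: "finite I" "set w \<subseteq> I" and ind: "indep_vars (\<lambda>_. borel) Z I"
    and int: "\<And>i q. i \<in> I \<Longrightarrow> integrable M (\<lambda>\<omega>. Z i \<omega> ^ q)"
  shows integrable_word_indep: "integrable M (\<lambda>\<omega>. \<Prod>i\<leftarrow>w. Z i \<omega>)"
    and expectation_word_indep:
      "expectation (\<lambda>\<omega>. \<Prod>i\<leftarrow>w. Z i \<omega>) = (\<Prod>i\<in>I. expectation (\<lambda>\<omega>. Z i \<omega> ^ count_list w i))"
proof -
  have "indep_vars (\<lambda>_. borel) (\<lambda>i \<omega>. Z i \<omega> ^ count_list w i) I"
    using indep_vars_compose2[OF ind, of "\<lambda>i x. x ^ count_list w i" "\<lambda>_. borel"] by simp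
  note * = I(1) this int
  show "integrable M (\<lambda>\<omega>. \<Prod>i\<leftarrow>w. Z i \<omega>)"
    unfolding prod_list_map_eq_prod_count[OF I] by (rule indep_vars_integrable[OF *])
  show "expectation (\<lambda>\<omega>. \<Prod>i\<leftarrow>w. Z i \<omega>) = (\<Prod>i\<in>I. expectation (\<lambda>\<omega>. Z i \<omega> ^ count_list w i))"
    unfolding prod_list_map_eq_prod_count[OF I] by (rule indep_vars_lebesgue_integral[OF *])
qed

text \<open>Telescoping a difference of products also needs bounds on the factors, so boundedness on
  \<open>A\<close> and approximation on \<open>G\<close> go through the induction together.\<close>

lemma prod_uniform_approx:
  fixes F :: "'i \<Rightarrow> 'x \<Rightarrow> real"
  assumes "finite I" and e: "\<And>x. 0 \<le> e x" and "\<And>x. G x \<Longrightarrow> A x"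
    and F: "\<And>i. i \<in> I \<Longrightarrow> \<exists>C\<ge>0. \<forall>x. (A x \<longrightarrow> \<bar>F i x\<bar> \<le> C) \<and> (G x \<longrightarrow> \<bar>F i x - g i\<bar> \<le> C * e x)"
  shows "\<exists>C\<ge>0. \<forall>x. (A x \<longrightarrow> \<bar>\<Prod>i\<in>I. F i x\<bar> \<le> C) \<and>
    (G x \<longrightarrow> \<bar>(\<Prod>i\<in>I. F i x) - (\<Prod>i\<in>I. g i)\<bar> \<le> C * e x)"
  using assms(1) F
proof (induction I rule: finite_induct)
  case empty
  show ?case using e by (intro exI[of _ 1]) auto
next
  case (insert i I)
  define P where "P x = (\<Prod>i\<in>I. F i x)" for x
  define p where "p = (\<Prod>i\<in>I. g i)"
  obtain C where C: "C \<ge> 0" "\<And>x. A x \<Longrightarrow> \<bar>P x\<bar> \<le> C" "\<And>x. G x \<Longrightarrow> \<bar>P x - p\<bar> \<le> C * e x"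
    using insert.IH insert.prems unfolding P_def p_def by (metis insertI2)
  obtain D where D: "D \<ge> 0" "\<And>x. A x \<Longrightarrow> \<bar>F i x\<bar> \<le> D" "\<And>x. G x \<Longrightarrow> \<bar>F i x - g i\<bar> \<le> D * e x"
    using insert.prems[of i] by auto
  have "\<exists>E\<ge>0. \<forall>x. (A x \<longrightarrow> \<bar>F i x * P x\<bar> \<le> E) \<and> (G x \<longrightarrow> \<bar>F i x * P x - g i * p\<bar> \<le> E * e x)"
  proof (intro exI[of _ "D * C + D * \<bar>p\<bar>"] conjI allI impI)
    show "0 \<le> D * C + D * \<bar>p\<bar>" using C(1) D(1) by simp
  next
    fix x assume "A x"
    then have "\<bar>F i x * P x\<bar> \<le> D * C" unfolding abs_mult using C D by (intro mult_mono) auto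
    then show "\<bar>F i x * P x\<bar> \<le> D * C + D * \<bar>p\<bar>" using D(1) by (simp add: add_increasing2)
  next
    fix x assume x: "G x"
    have "\<bar>F i x * P x - g i * p\<bar> = \<bar>F i x * (P x - p) + (F i x - g i) * p\<bar>"
      by (simp add: algebra_simps)
    also have "\<dots> \<le> \<bar>F i x\<bar> * \<bar>P x - p\<bar> + \<bar>F i x - g i\<bar> * \<bar>p\<bar>"
      by (metis abs_mult abs_triangle_ineq)
    also have "\<dots> \<le> D * (C * e x) + (D * e x) * \<bar>p\<bar>"
      using x assms(3)[OF x] C D e by (intro add_mono mult_mono) auto
    finally show "\<bar>F i x * P x - g i * p\<bar> \<le> (D * C + D * \<bar>p\<bar>) * e x"
      by (simp add: algebra_simps)
  qed
  then show ?case using insert.hyps by (simp add: P_def p_def)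
qed

text \<open>Exceptional frequencies solve \<open>2 * k = n * q\<close> with \<open>q\<close> equal
  to 0 or 1, so there are at most two for each \<open>n\<close>. Boundedness of \<open>f\<close>
  makes their share of order \<open>1 / n\<close>, and the others are uniformly close to
  \<open>L\<close>.\<close>

lemma average_tendsto:
  fixes f :: "nat \<Rightarrow> nat \<Rightarrow> real"
  assumes f: "\<And>n k. n \<ge> 4 \<Longrightarrow> \<bar>f n k\<bar> \<le> C"
    "\<And>n k. n \<ge> 4 \<Longrightarrow> \<not> n dvd 2 * k \<Longrightarrow> \<bar>f n k - L\<bar> \<le> C * (1 / sqrt n)"
  shows "(\<lambda>n. (\<Sum>k<n. f n k) / real n) \<longlonglongrightarrow> L"
proof -
  define D where "D = C + \<bar>L\<bar>"
  have C0: "0 \<le> C" using f(1)[of 4 0] by simp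
  have bound: "\<bar>(\<Sum>k<n. f n k) / real n - L\<bar> \<le> C * (1 / sqrt n) + 2 * D / real n" if n: "n \<ge> 4" for n
  proof -
    have sub: "{k \<in> {..<n}. n dvd 2 * k} \<subseteq> {0, n div 2}"
    proof
      fix k assume "k \<in> {k \<in> {..<n}. n dvd 2 * k}"
      then obtain q where q: "2 * k = n * q" and "k < n" by auto
      then have "n * q < n * 2" by linarith
      then have "q < 2" by simp
      then have "q = 0 \<or> q = 1" by auto
      with q show "k \<in> {0, n div 2}" using n by auto
    qed
    have card: "card {k \<in> {..<n}. n dvd 2 * k} \<le> 2"
      using card_mono[OF _ sub] by (auto simp: card_insert_if split: if_splits)
    have "\<bar>(\<Sum>k<n. f n k) - real n * L\<bar> = \<bar>\<Sum>k<n. f n k - L\<bar>" by (simp add: sum_subtractf)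
    also have "\<dots> \<le> (\<Sum>k<n. C * (1 / sqrt n) + (if n dvd 2 * k then D else 0))"
    proof (intro order_trans[OF sum_abs] sum_mono)
      fix k
      have "\<bar>f n k - L\<bar> \<le> D" using f(1)[OF n, of k] by (simp add: D_def)
      then show "\<bar>f n k - L\<bar> \<le> C * (1 / sqrt n) + (if n dvd 2 * k then D else 0)"
        using f(2)[OF n, of k] C0 by (auto intro: add_increasing)
    qed
    also have "\<dots> = real n * (C * (1 / sqrt n)) + real (card {k \<in> {..<n}. n dvd 2 * k}) * D"
      unfolding sum.distrib by (subst sum.inter_filter[symmetric]) auto
    also have "\<dots> \<le> real n * (C * (1 / sqrt n)) + 2 * D"
      using card C0 by (intro add_left_mono mult_right_mono) (auto simp: D_def)
    finally have "\<bar>(\<Sum>k<n. f n k) - real n * L\<bar> / real n \<le> (real n * (C * (1 / sqrt n)) + 2 * D) / real n"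
      by (intro divide_right_mono) auto
    moreover have "(\<Sum>k<n. f n k) / real n - L = ((\<Sum>k<n. f n k) - real n * L) / real n"
      using n by (simp add: field_simps)
    ultimately show ?thesis using n by (simp add: add_divide_distrib)
  qed
  have "(\<lambda>n. C * (1 / sqrt (real n)) + 2 * D / real n) \<longlonglongrightarrow> C * 0 + 0"
    by (intro tendsto_intros tendsto_divide_0[OF tendsto_const] filterlim_real_sequentially
          filterlim_at_top_imp_at_infinity filterlim_compose[OF sqrt_at_top])
  then have "(\<lambda>n. C * (1 / sqrt (real n)) + 2 * D / real n) \<longlonglongrightarrow> 0" by simp
  moreover have "eventually (\<lambda>n. norm ((\<Sum>k<n. f n k) / real n - L) \<le> C * (1 / sqrt (real n)) + 2 * D / real n) sequentially"
    using bound by (intro eventually_sequentiallyI[of 4]) auto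
  ultimately have "(\<lambda>n. (\<Sum>k<n. f n k) / real n - L) \<longlonglongrightarrow> 0"
    by (rule Lim_null_comparison[rotated])
  then show ?thesis by (simp add: LIM_zero_iff)
qed

text \<open>The recursion is solved in closed form, even and odd orders in one induction, to match
  the known integrals against the standard normal density.\<close>

lemma std_normal_moment:
  "integral\<^sup>L lborel (\<lambda>x. std_normal_density x * x ^ p) = gauss_moment p 1"
proof -
  have "gauss_moment (2 * k) 1 = fact (2 * k) / (2 ^ k * fact k)
      \<and> gauss_moment (2 * k + 1) 1 = 0" for k
  proof (induction k)
    case (Suc k)
    have "gauss_moment (2 * Suc k) 1 = real (2 * k + 1) * gauss_moment (2 * k) 1" by simp
    also have "\<dots> = real (2 * k + 1) * (fact (2 * k) / (2 ^ k * fact k))" using Suc by simp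
    also have "\<dots> = (2 * real (Suc k) * (real (2 * k + 1) * fact (2 * k))) / (2 ^ Suc k * fact (Suc k))"
      by (simp del: of_nat_Suc)
    also have "2 * real (Suc k) * (real (2 * k + 1) * fact (2 * k)) = fact (2 * Suc k)"
      by (simp add: algebra_simps)
    finally show ?case using Suc by simp
  qed simp
  moreover obtain k where "p = 2 * k \<or> p = 2 * k + 1" by (metis evenE oddE)
  ultimately show ?thesis
    using integral_std_normal_moment_even[of k] integral_std_normal_moment_odd[of k] by metis
qed

lemma (in prob_space)
  assumes D: "distributed M lborel X std_normal_density"
  shows integrable_power_std_normal: "integrable M (\<lambda>\<omega>. X \<omega> ^ p)"
    and expectation_power_std_normal: "expectation (\<lambda>\<omega>. X \<omega> ^ p) = gauss_moment p 1"
  using distributed_integrable[OF D, of "\<lambda>x. x ^ p"] distributed_integral[OF D, of "\<lambda>x. x ^ p"]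
    integrable_std_normal_moment[of p] std_normal_moment[of p]
  by auto

subsection \<open>Convergence\<close>

text \<open>The uniform moment hypothesis supplies \<open>K q\<close> as the real value of the
  supremum over \<open>j\<close>; its nonnegativity for every \<open>q\<close> is built into
  \<open>enn2real\<close>.\<close>

lemma (in prob_space) circ_eig_family_moments:
  fixes X :: "nat \<Rightarrow> 'a \<Rightarrow> real"
  assumes rv: "\<And>j. X j \<in> borel_measurable M"
    and ind: "indep_vars (\<lambda>_. borel) X UNIV"
    and mean: "\<And>j. expectation (X j) = 0"
    and var: "\<And>j. expectation (\<lambda>\<omega>. (X j \<omega>)\<^sup>2) = 1"
    and mom: "\<And>k. k \<ge> 3 \<Longrightarrow> (SUP j. \<integral>\<^sup>+ \<omega>. ennreal (\<bar>X j \<omega>\<bar> ^ k) \<partial>M) < \<infinity>"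
  shows "n > 0 \<Longrightarrow> integrable M (\<lambda>\<omega>. circ_eig n k (\<lambda>j. X j \<omega>) ^ p)"
    and "\<exists>C\<ge>0. \<forall>n k. n \<ge> 4 \<longrightarrow>
      \<bar>expectation (\<lambda>\<omega>. circ_eig n k (\<lambda>j. X j \<omega>) ^ p)\<bar> \<le> C \<and>
      (\<not> n dvd 2 * k \<longrightarrow> \<bar>expectation (\<lambda>\<omega>. circ_eig n k (\<lambda>j. X j \<omega>) ^ p) - gauss_moment p 1\<bar> \<le> C * (1 / sqrt n))"
proof -
  have le: "(\<integral>\<^sup>+ \<omega>. ennreal (\<bar>X j \<omega>\<bar> ^ k) \<partial>M) \<le> (SUP j. \<integral>\<^sup>+ \<omega>. ennreal (\<bar>X j \<omega>\<bar> ^ k) \<partial>M)" for j k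
    by (rule SUP_upper) simp
  have int: "integrable M (\<lambda>\<omega>. X j \<omega> ^ q)" for j q
    by (rule integrable_power_of_moment_bound[OF rv var order.strict_trans1[OF le mom]])
  have K: "\<bar>expectation (\<lambda>\<omega>. X j \<omega> ^ q)\<bar> \<le> enn2real (SUP j. \<integral>\<^sup>+ \<omega>. ennreal (\<bar>X j \<omega>\<bar> ^ q) \<partial>M)"
    if "q \<ge> 3" for j q
    by (rule abs_moment_le[OF int le mom[OF that]])
  note * = circ_eig_moments[OF ind mean var int K enn2real_nonneg]
  show "n > 0 \<Longrightarrow> integrable M (\<lambda>\<omega>. circ_eig n k (\<lambda>j. X j \<omega>) ^ p)"
    by (rule *(1))
  show "\<exists>C\<ge>0. \<forall>n k. n \<ge> 4 \<longrightarrow>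
      \<bar>expectation (\<lambda>\<omega>. circ_eig n k (\<lambda>j. X j \<omega>) ^ p)\<bar> \<le> C \<and>
      (\<not> n dvd 2 * k \<longrightarrow> \<bar>expectation (\<lambda>\<omega>. circ_eig n k (\<lambda>j. X j \<omega>) ^ p) - gauss_moment p 1\<bar> \<le> C * (1 / sqrt n))"
    by (rule *(2))
qed

lemma prod_nth_eq_prod_list:
  fixes f :: "'i \<Rightarrow> 'c :: comm_monoid_mult"
  shows "(\<Prod>k<length w. f (w ! k)) = (\<Prod>i\<leftarrow>w. f i)"
  by (induction w) (simp_all add: prod.lessThan_Suc_shift del: prod.lessThan_Suc)

lemma of_real_prod_list:
  "of_real (\<Prod>i\<leftarrow>w. f i) = (\<Prod>i\<leftarrow>w. of_real (f i) :: 'c :: {real_algebra_1, comm_monoid_mult})"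
  by (induction w) simp_all

text \<open>Independence of the families concerns whole sequences in a product space; it passes to
  the eigenvalues because these are measurable functions of such sequences.\<close>

lemma borel_measurable_circ_eig [measurable]:
  "circ_eig n k \<in> borel_measurable (Pi\<^sub>M UNIV (\<lambda>j. borel))"
  unfolding circ_eig_def[abs_def] by measurable

theorem theorem4:
  fixes M :: "'a measure" and N :: "'b measure"
    and m :: nat
    and X :: "nat \<Rightarrow> nat \<Rightarrow> 'a \<Rightarrow> real"
    and b :: "nat \<Rightarrow> 'b \<Rightarrow> real"
    and Q :: "nat list \<Rightarrow> complex"
  assumes "prob_space M"
    and "m \<ge> 1"
    and rv: "\<And>i j. i \<in> {1..m} \<Longrightarrow> X i j \<in> borel_measurable M"
    and indep_families:
      "prob_space.indep_vars M (\<lambda>i. Pi\<^sub>M UNIV (\<lambda>j. borel)) (\<lambda>i \<omega> j. X i j \<omega>) {1..m}"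
    and indep_within: "\<And>i. i \<in> {1..m} \<Longrightarrow> prob_space.indep_vars M (\<lambda>j. borel) (X i) UNIV"
    and mean0: "\<And>i j. i \<in> {1..m} \<Longrightarrow> prob_space.expectation M (X i j) = 0"
    and var1: "\<And>i j. i \<in> {1..m} \<Longrightarrow> prob_space.expectation M (\<lambda>\<omega>. (X i j \<omega>)^2) = 1"
    and moments: "\<And>i k. i \<in> {1..m} \<Longrightarrow> k \<ge> 3 \<Longrightarrow>
        (SUP j. \<integral>\<^sup>+ \<omega>. ennreal (\<bar>X i j \<omega>\<bar> ^ k) \<partial>M) < \<infinity>"
    and "prob_space N"
    and b_indep: "prob_space.indep_vars N (\<lambda>i. borel) b {1..m}"
    and b_gauss: "\<And>i. i \<in> {1..m} \<Longrightarrow> distributed N lborel (b i) std_normal_density"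
    and "nc_poly m Q"
  shows "(\<lambda>n. phi_n M n (nc_eval_mat n Q (\<lambda>i. symcirc n (X i))))
           \<longlonglongrightarrow> (\<integral>\<omega>. nc_eval_rv Q b \<omega> \<partial>N)"
proof -
  interpret M: prob_space M by fact
  interpret N: prob_space N by fact
  define W where "W = {w. Q w \<noteq> 0}"
  have W: "finite W" "\<And>w. w \<in> W \<Longrightarrow> set w \<subseteq> {1..m}"
    using \<open>nc_poly m Q\<close> by (auto simp: W_def nc_poly_def)
  define eig where "eig n k i \<omega> = circ_eig n k (\<lambda>j. X i j \<omega>)" for n k i \<omega>
  define g where "g w = (\<Prod>i\<in>{1..m}. gauss_moment (count_list w i) 1)" for w
  define \<mu> where "\<mu> w n k = M.expectation (\<lambda>\<omega>. \<Prod>i\<leftarrow>w. eig n k i \<omega>)" for w n k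
  have eig_pow: "integrable M (\<lambda>\<omega>. eig n k i \<omega> ^ p)" if "i \<in> {1..m}" "n > 0" for i n k p
    unfolding eig_def using that
    by (intro M.circ_eig_family_moments(1) rv indep_within mean0 var1 moments)
  have eig_exp: "\<exists>C\<ge>0. \<forall>n k. n \<ge> 4 \<longrightarrow> \<bar>M.expectation (\<lambda>\<omega>. eig n k i \<omega> ^ p)\<bar> \<le> C \<and>
      (\<not> n dvd 2 * k \<longrightarrow> \<bar>M.expectation (\<lambda>\<omega>. eig n k i \<omega> ^ p) - gauss_moment p 1\<bar> \<le> C * (1 / sqrt n))"
    if "i \<in> {1..m}" for i p
    unfolding eig_def using that
    by (intro M.circ_eig_family_moments(2) rv indep_within mean0 var1 moments)
  \<comment> \<open>For fixed \<open>n\<close> and \<open>k\<close> each eigenvalue uses a single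
    family, so independence is inherited across \<open>i\<close>; nothing is claimed across
    different \<open>k\<close>.\<close>
  have eig_ind: "M.indep_vars (\<lambda>_. borel) (eig n k) {1..m}" for n k
    using M.indep_vars_compose2[OF indep_families, of "\<lambda>_. circ_eig n k" "\<lambda>_. borel"]
    by (simp add: eig_def[abs_def])
  have eig_int: "integrable M (\<lambda>\<omega>. \<Prod>i\<leftarrow>w. eig n k i \<omega>)" if "w \<in> W" "n > 0" for w n k
    by (rule M.integrable_word_indep[OF _ W(2)[OF that(1)] eig_ind eig_pow]) (use that in auto)
  have \<mu>: "\<mu> w n k = (\<Prod>i\<in>{1..m}. M.expectation (\<lambda>\<omega>. eig n k i \<omega> ^ count_list w i))"
    if "w \<in> W" "n > 0" for w n k
    unfolding \<mu>_def
    by (rule M.expectation_word_indep[OF _ W(2)[OF that(1)] eig_ind eig_pow]) (use that in auto)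

  have lim: "(\<lambda>n. (\<Sum>k<n. \<mu> w n k) / real n) \<longlonglongrightarrow> g w" if w: "w \<in> W" for w
  proof -
    \<comment> \<open>Size and frequency are packed into one pair, so that the product estimate
      yields a single constant for all of them.\<close>
    have "\<exists>C\<ge>0. \<forall>x. (fst x \<ge> 4 \<longrightarrow> \<bar>\<Prod>i\<in>{1..m}. M.expectation (\<lambda>\<omega>. eig (fst x) (snd x) i \<omega> ^ count_list w i)\<bar> \<le> C) \<and>
      (fst x \<ge> 4 \<and> \<not> fst x dvd 2 * snd x \<longrightarrow>
        \<bar>(\<Prod>i\<in>{1..m}. M.expectation (\<lambda>\<omega>. eig (fst x) (snd x) i \<omega> ^ count_list w i))
          - (\<Prod>i\<in>{1..m}. gauss_moment (count_list w i) 1)\<bar> \<le> C * (1 / sqrt (fst x)))"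
    proof (rule prod_uniform_approx)
      fix i assume "i \<in> {1..m}"
      from eig_exp[OF this, of "count_list w i"]
      obtain C where "C \<ge> 0"
        "\<And>n k. n \<ge> 4 \<Longrightarrow> \<bar>M.expectation (\<lambda>\<omega>. eig n k i \<omega> ^ count_list w i)\<bar> \<le> C"
        "\<And>n k. n \<ge> 4 \<Longrightarrow> \<not> n dvd 2 * k \<Longrightarrow>
          \<bar>M.expectation (\<lambda>\<omega>. eig n k i \<omega> ^ count_list w i) - gauss_moment (count_list w i) 1\<bar> \<le> C * (1 / sqrt n)"
        by blast
      then show "\<exists>C\<ge>0. \<forall>x. (fst x \<ge> 4 \<longrightarrow> \<bar>M.expectation (\<lambda>\<omega>. eig (fst x) (snd x) i \<omega> ^ count_list w i)\<bar> \<le> C) \<and>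
        (fst x \<ge> 4 \<and> \<not> fst x dvd 2 * snd x \<longrightarrow>
          \<bar>M.expectation (\<lambda>\<omega>. eig (fst x) (snd x) i \<omega> ^ count_list w i) - gauss_moment (count_list w i) 1\<bar>
            \<le> C * (1 / sqrt (fst x)))"
        by (intro exI[of _ C] conjI allI impI) simp_all
    qed auto
    then obtain C where C: "\<forall>x. (fst x \<ge> 4 \<longrightarrow> \<bar>\<Prod>i\<in>{1..m}. M.expectation (\<lambda>\<omega>. eig (fst x) (snd x) i \<omega> ^ count_list w i)\<bar> \<le> C) \<and>
      (fst x \<ge> 4 \<and> \<not> fst x dvd 2 * snd x \<longrightarrow>
        \<bar>(\<Prod>i\<in>{1..m}. M.expectation (\<lambda>\<omega>. eig (fst x) (snd x) i \<omega> ^ count_list w i)) - g w\<bar> \<le> C * (1 / sqrt (fst x)))"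
      unfolding g_def by blast
    show ?thesis
    proof (rule average_tendsto)
      fix n k :: nat assume "n \<ge> 4"
      then show "\<bar>\<mu> w n k\<bar> \<le> C" using C[rule_format, of "(n, k)"] by (simp add: \<mu>[OF w])
    next
      fix n k :: nat assume "n \<ge> 4" "\<not> n dvd 2 * k"
      then show "\<bar>\<mu> w n k - g w\<bar> \<le> C * (1 / sqrt n)"
        using C[rule_format, of "(n, k)"] by (simp add: \<mu>[OF w])
    qed
  qed

  have phi: "phi_n M n (nc_eval_mat n Q (\<lambda>i. symcirc n (X i)))
      = (\<Sum>w\<in>W. Q w * of_real ((\<Sum>k<n. \<mu> w n k) / real n))" if n: "n > 0" for n
  proof -
    \<comment> \<open>The trace is evaluated at each sample point before integrating, so
      integrability is needed only for products of eigenvalues.\<close>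
    have "(\<Sum>r<n. nc_eval_mat n Q (\<lambda>i. symcirc n (X i)) \<omega> r r)
        = (\<Sum>w\<in>W. Q w * of_real (\<Sum>k<n. \<Prod>i\<leftarrow>w. eig n k i \<omega>))" for \<omega>
      unfolding nc_eval_mat_def W_def[symmetric] eig_def trace_rmat_word[symmetric] sum_distrib_left
      by (rule sum.swap)
    then have "phi_n M n (nc_eval_mat n Q (\<lambda>i. symcirc n (X i)))
        = 1 / of_nat n * (\<integral>\<omega>. (\<Sum>w\<in>W. Q w * of_real (\<Sum>k<n. \<Prod>i\<leftarrow>w. eig n k i \<omega>)) \<partial>M)"
      by (simp only: phi_n_def)
    also have "(\<integral>\<omega>. (\<Sum>w\<in>W. Q w * of_real (\<Sum>k<n. \<Prod>i\<leftarrow>w. eig n k i \<omega>)) \<partial>M)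
        = (\<Sum>w\<in>W. \<integral>\<omega>. Q w * of_real (\<Sum>k<n. \<Prod>i\<leftarrow>w. eig n k i \<omega>) \<partial>M)"
      using n by (intro Bochner_Integration.integral_sum integrable_mult_right integrable_of_real
          Bochner_Integration.integrable_sum eig_int)
    also have "\<dots> = (\<Sum>w\<in>W. Q w * of_real (\<Sum>k<n. \<mu> w n k))"
    proof (rule sum.cong[OF refl])
      fix w assume w: "w \<in> W"
      have "(\<integral>\<omega>. (\<Sum>k<n. \<Prod>i\<leftarrow>w. eig n k i \<omega>) \<partial>M) = (\<Sum>k<n. \<mu> w n k)"
        unfolding \<mu>_def by (intro Bochner_Integration.integral_sum eig_int w n)
      then show "(\<integral>\<omega>. Q w * of_real (\<Sum>k<n. \<Prod>i\<leftarrow>w. eig n k i \<omega>) \<partial>M) = Q w * of_real (\<Sum>k<n. \<mu> w n k)"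
        by (simp only: integral_mult_right_zero integral_complex_of_real)
    qed
    finally show ?thesis by (simp add: sum_divide_distrib[of _ W])
  qed

  \<comment> \<open>Independent Gaussians give the same product of one-variable moments
    \<open>g w\<close>: only the letter counts of \<open>w\<close> matter on either side.\<close>
  have rhs: "(\<integral>\<omega>. nc_eval_rv Q b \<omega> \<partial>N) = (\<Sum>w\<in>W. Q w * of_real (g w))"
  proof -
    note b_pow = N.integrable_power_std_normal[OF b_gauss] N.expectation_power_std_normal[OF b_gauss]
    have b_int: "integrable N (\<lambda>\<omega>. \<Prod>i\<leftarrow>w. b i \<omega>)" if "w \<in> W" for w
      using that by (intro N.integrable_word_indep[OF _ W(2) b_indep b_pow(1)]) auto
    have b_exp: "N.expectation (\<lambda>\<omega>. \<Prod>i\<leftarrow>w. b i \<omega>) = g w" if "w \<in> W" for w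
      using N.expectation_word_indep[OF _ W(2)[OF that] b_indep b_pow(1)] b_pow(2)
      by (simp add: g_def)
    have "(\<integral>\<omega>. nc_eval_rv Q b \<omega> \<partial>N) = (\<integral>\<omega>. (\<Sum>w\<in>W. Q w * of_real (\<Prod>i\<leftarrow>w. b i \<omega>)) \<partial>N)"
      by (simp only: nc_eval_rv_def W_def prod_nth_eq_prod_list[where f = "\<lambda>i. complex_of_real (b i _)"] of_real_prod_list)
    also have "\<dots> = (\<Sum>w\<in>W. \<integral>\<omega>. Q w * of_real (\<Prod>i\<leftarrow>w. b i \<omega>) \<partial>N)"
      by (intro Bochner_Integration.integral_sum integrable_mult_right integrable_of_real b_int)
    also have "\<dots> = (\<Sum>w\<in>W. Q w * of_real (g w))"
      by (intro sum.cong refl) (simp only: integral_mult_right_zero integral_complex_of_real b_exp)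
    finally show ?thesis .
  qed

  have "(\<lambda>n. \<Sum>w\<in>W. Q w * of_real ((\<Sum>k<n. \<mu> w n k) / real n)) \<longlonglongrightarrow> (\<Sum>w\<in>W. Q w * of_real (g w))"
    by (intro tendsto_sum tendsto_mult tendsto_const tendsto_of_real lim)
  moreover have "eventually (\<lambda>n. (\<Sum>w\<in>W. Q w * of_real ((\<Sum>k<n. \<mu> w n k) / real n))
      = phi_n M n (nc_eval_mat n Q (\<lambda>i. symcirc n (X i)))) sequentially"
    using phi by (auto intro!: eventually_sequentiallyI[of 1])
  ultimately show ?thesis
    unfolding rhs by (rule Lim_transform_eventually)
qed

end
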